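(* The solution of the Bagley-Torvik equation $$a\,y''(t)+b\;{}_{0}^{\ast}D_{t}^{3/2}y(t)+c\,y(t)=\Omega\,\sin\omega t,\qquad t>0,$$ with $a,b,c,\Omega,\omega\in\mathbb{R}$ and initial conditions $y(0),y'(0)\in\mathbb{R}$, is given by $$y(t)=y_f(t)+y_c(t),$$ where $$y_c(t)=\sum_{k=1}^{4}\frac{(a\,r_k+b)\left[r_k^2\,y(0)+y'(0)\right]}{(4a\,r_k+3b)\,r_k^2}\exp(r_k^2t)\,\mathrm{erfc}(-r_k\sqrt{t})$$ and $$\begin{aligned} y_f(t)={}&\Omega\left[\omega\left(\sum_{k=1}^{4}\frac{\exp(r_k^2t)\,\mathrm{erfc}(-r_k\sqrt{t})}{r_k(4a\,r_k+3b)(\omega^2+r_k^4)}-B_{-1}\cos\omega t\right)-B_1\sin\omega t\right]\\ &+\Omega\sqrt{\frac{2}{\omega}}\left[\mathrm{S}\left(\sqrt{\frac{2\omega}{\pi}t}\right)\left(B_2\cos\omega t-B_0\,\omega\sin\omega t\right)-\mathrm{C}\left(\sqrt{\frac{2\omega}{\pi}t}\right)\left(B_2\sin\omega t+B_0\,\omega\cos\omega t\right)\right], \end{aligned}$$ with the constants $$B_m=\sum_{k=1}^{4}\frac{r_k^m}{(4a\,r_k+3b)(\omega^2+r_k^4)},$$ and where $r_k$ $(k=1,2,3,4)$ are the $4$ different roots of the polynomial $P(r)=a\,r^{4}+b\,r^{3}+c$, which are given by $$r_{1,2}=-\frac{\beta}{4}\pm R+T_{\pm},\qquad r_{3,4}=-\frac{\beta}{4}\pm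 R-T_{\pm},$$ where $$\beta=\frac{b}{a},\quad \gamma=\frac{c}{a},\quad \delta=\left(9\beta^2+\sqrt{81\beta^4-768\gamma}\right)\gamma,$$ $$R=\frac12\sqrt{\left(\frac{\beta}{2}\right)^2+\left(\frac{\delta}{18}\right)^{1/3}+\frac{8\gamma}{(12\delta)^{1/3}}},$$ $$T_{\pm}=\frac12\sqrt{\frac{\beta^2}{2}-4\gamma\left(\frac{2}{3\delta}\right)^{1/3}-\left(\frac{\delta}{18}\right)^{1/3}\mp\frac{\beta^3}{8R}}.$$
   Context: The Caputo fractional derivative of order $3/2$ is $${}_{0}^{\ast}D_{t}^{3/2}g(t)=\frac{1}{\Gamma(1/2)}\int_0^t\frac{g''(\tau)}{(t-\tau)^{1/2}}\,d\tau ,$$ where $\Gamma$ is the gamma function. The complementary error function is $\mathrm{erfc}(z)=1-\frac{2}{\sqrt{\pi}}\int_0^z e^{-u^2}\,du$, for complex $z$. The Fresnel integrals are $$\mathrm{S}(z)=\int_0^z\sin\left(\frac{\pi u^2}{2}\right)du,\qquad \mathrm{C}(z)=\int_0^z\cos\left(\frac{\pi u^2}{2}\right)du.$$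
   Formalization: Roots are principal; (2/(3δ))^{1/3} is taken as 2^{1/3}/(3δ)^{1/3} (matters if c/a<0) and √(2/ω) as √2/√ω (matters if ω<0), since the printed forms fail there; for ω=0, y_f is 0; the roots r_k are assumed distinct with ω²+r_k⁴≠0, without which the formula divides by zero. *)

theory Defs
  imports "HOL-Complex_Analysis.Complex_Analysis"
begin

text \<open>The integrands are entire, so the choice of the straight path from 0 to z is immaterial.\<close>

definition erfc :: "complex \<Rightarrow> complex" where
  "erfc z = 1 - 2 / of_real (sqrt pi) * contour_integral (linepath 0 z) (\<lambda>u. exp (- (u\<^sup>2)))"

definition fresnel_S :: "complex \<Rightarrow> complex" where
  "fresnel_S z = contour_integral (linepath 0 z) (\<lambda>u. sin (of_real pi * u\<^sup>2 / 2))"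

definition fresnel_C :: "complex \<Rightarrow> complex" where
  "fresnel_C z = contour_integral (linepath 0 z) (\<lambda>u. cos (of_real pi * u\<^sup>2 / 2))"

text \<open>The integrand is meaningful for \<open>0 < \<tau> < t\<close>; its values at the two endpoints do not
  affect the integral, so only the restriction of \<open>g\<close> to \<open>{0<..}\<close> matters.\<close>

definition caputo_3_2 :: "(real \<Rightarrow> real) \<Rightarrow> real \<Rightarrow> real" where
  "caputo_3_2 g t =
     1 / Gamma (1/2) * integral {0..t} (\<lambda>\<tau>. deriv (deriv g) \<tau> / sqrt (t - \<tau>))"

text \<open>A solution on \<open>[0,\<infinity>)\<close> with \<open>y(0) = y0\<close> and \<open>y'(0) = v0\<close> (a one-sided derivative).
  Only what is needed for the equation to make sense is required: \<open>y\<close> is twice differentiable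
  on \<open>(0,\<infinity>)\<close> and the integral in the Caputo derivative exists in the Lebesgue sense.
  Values of \<open>y\<close> at negative arguments are irrelevant.\<close>

definition bagley_torvik_solution ::
  "real \<Rightarrow> real \<Rightarrow> real \<Rightarrow> real \<Rightarrow> real \<Rightarrow> real \<Rightarrow> real \<Rightarrow> (real \<Rightarrow> real) \<Rightarrow> bool" where
  "bagley_torvik_solution a b c \<Omega> \<omega> y0 v0 y \<longleftrightarrow>
     y 0 = y0 \<and> (y has_real_derivative v0) (at 0 within {0..}) \<and>
     (\<forall>t>0. y differentiable (at t) \<and> deriv y differentiable (at t) \<and>
        (\<lambda>\<tau>. deriv (deriv y) \<tau> / sqrt (t - \<tau>)) absolutely_integrable_on {0..t} \<and>
        a * deriv (deriv y) t + b * caputo_3_2 y t + c * y t = \<Omega> * sin (\<omega> * t))"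

definition bt_poly :: "real \<Rightarrow> real \<Rightarrow> real \<Rightarrow> complex poly" where
  "bt_poly a b c = [:of_real c, 0, 0, of_real b, of_real a:]"

text \<open>Radicals are principal complex roots. In \<open>bt_T2\<close> the factor \<open>(2/(3\<delta>))^(1/3)\<close> is read as the
  quotient of the principal cube roots of \<open>2\<close> and \<open>3\<delta>\<close>. The two readings differ only if \<open>\<delta>\<close> is a
  negative real number (that is, \<open>c/a < 0\<close>), and then the principal cube root of the quotient
  would not be compatible with \<open>(\<delta>/18)^(1/3)\<close> and would not give roots of the quartic.\<close>

definition bt_delta :: "complex \<Rightarrow> complex \<Rightarrow> complex" where
  "bt_delta \<beta> \<gamma> = (9 * \<beta>^2 + csqrt (81 * \<beta>^4 - 768 * \<gamma>)) * \<gamma>"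

definition bt_R :: "complex \<Rightarrow> complex \<Rightarrow> complex" where
  "bt_R \<beta> \<gamma> = (let \<delta> = bt_delta \<beta> \<gamma> in
     1/2 * csqrt ((\<beta>/2)^2 + (\<delta>/18) powr (1/3) + 8 * \<gamma> / (12 * \<delta>) powr (1/3)))"

text \<open>\<open>T\<^sub>+\<close> is the case \<open>\<sigma> = 1\<close>, \<open>T\<^sub>-\<close> the case \<open>\<sigma> = -1\<close>.\<close>

definition bt_T :: "complex \<Rightarrow> complex \<Rightarrow> complex \<Rightarrow> complex" where
  "bt_T \<sigma> \<beta> \<gamma> = (let \<delta> = bt_delta \<beta> \<gamma> in
     1/2 * csqrt (\<beta>^2 / 2 - 4 * \<gamma> * (2 powr (1/3) / (3 * \<delta>) powr (1/3))
                   - (\<delta>/18) powr (1/3) - \<sigma> * (\<beta>^3 / (8 * bt_R \<beta> \<gamma>))))"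

definition bt_root :: "real \<Rightarrow> real \<Rightarrow> real \<Rightarrow> nat \<Rightarrow> complex" where
  "bt_root a b c k = (let \<beta> = of_real (b / a); \<gamma> = of_real (c / a) in
     if k = 1 then - \<beta>/4 + bt_R \<beta> \<gamma> + bt_T 1 \<beta> \<gamma>
     else if k = 2 then - \<beta>/4 - bt_R \<beta> \<gamma> + bt_T (-1) \<beta> \<gamma>
     else if k = 3 then - \<beta>/4 + bt_R \<beta> \<gamma> - bt_T 1 \<beta> \<gamma>
     else - \<beta>/4 - bt_R \<beta> \<gamma> - bt_T (-1) \<beta> \<gamma>)"

definition bt_B :: "real \<Rightarrow> real \<Rightarrow> real \<Rightarrow> (nat \<Rightarrow> complex) \<Rightarrow> int \<Rightarrow> complex" where
  "bt_B a b \<omega> r m =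
     (\<Sum>k=1..4. r k powi m / ((4 * of_real a * r k + 3 * of_real b) * ((of_real \<omega>)^2 + r k ^ 4)))"

definition bt_yc ::
  "real \<Rightarrow> real \<Rightarrow> real \<Rightarrow> real \<Rightarrow> (nat \<Rightarrow> complex) \<Rightarrow> real \<Rightarrow> complex" where
  "bt_yc a b y0 v0 r t =
     (\<Sum>k=1..4. (of_real a * r k + of_real b) * ((r k)^2 * of_real y0 + of_real v0)
                / ((4 * of_real a * r k + 3 * of_real b) * (r k)^2)
                * exp ((r k)^2 * of_real t) * erfc (- r k * of_real (sqrt t)))"

text \<open>The factor \<open>\<surd>(2/\<omega>)\<close> is read as \<open>\<surd>2/\<surd>\<omega>\<close> with principal roots. This is the same number for
  \<open>\<omega> > 0\<close>; for \<open>\<omega> < 0\<close> it is the branch for which the product with the Fresnel integrals at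
  \<open>\<surd>(2\<omega>t/\<pi>)\<close> is \<open>\<integral>\<^sub>0\<^sup>t sin (\<omega>\<tau>)/\<surd>(\<pi>\<tau>) d\<tau>\<close>, respectively the same integral with \<open>cos\<close>. For
  \<open>\<omega> = 0\<close> every term of \<open>bt_yf\<close> vanishes, which is also its limit for \<open>\<omega> \<rightarrow> 0\<close>.\<close>

definition bt_yf ::
  "real \<Rightarrow> real \<Rightarrow> real \<Rightarrow> real \<Rightarrow> (nat \<Rightarrow> complex) \<Rightarrow> real \<Rightarrow> complex" where
  "bt_yf a b \<Omega> \<omega> r t = (let B = bt_B a b \<omega> r; x = csqrt (of_real (2 * \<omega> / pi * t));
       w = of_real \<omega>; C = of_real (cos (\<omega> * t)); S = of_real (sin (\<omega> * t)) in
     of_real \<Omega> *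
       (w * ((\<Sum>k=1..4. exp ((r k)^2 * of_real t) * erfc (- r k * of_real (sqrt t))
                / (r k * (4 * of_real a * r k + 3 * of_real b) * (w^2 + r k ^ 4)))
             - B (-1) * C)
        - B 1 * S)
     + of_real \<Omega> * (csqrt 2 / csqrt w) *
       (fresnel_S x * (B 2 * C - B 0 * w * S) - fresnel_C x * (B 2 * S + B 0 * w * C)))"

end

theory Submission
  imports Defs
begin

text \<open>
  Write \<open>P\<close> for the quartic \<open>a r\<^sup>4 + b r\<^sup>3 + c\<close>. The functions
  \<open>E\<^sub>r(t) = exp (r\<^sup>2 t) erfc (- r \<surd>t)\<close> behave like exponentials for calculus of half-integer order:
  half-order integration maps \<open>E\<^sub>r\<close> to \<open>(E\<^sub>r - 1)/r\<close>, and \<open>E\<^sub>r' = r\<^sup>2 E\<^sub>r + r/\<surd>(\<pi>t)\<close>. For a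
  finite sum \<open>y = \<Sum> \<alpha>\<^sub>r E\<^sub>r\<close> with \<open>\<Sum> \<alpha>\<^sub>r r = \<Sum> \<alpha>\<^sub>r r\<^sup>3 = 0\<close> the singular and the constant
  terms cancel, and the left-hand side of the Bagley-Torvik equation becomes
  \<open>\<Sum> \<alpha>\<^sub>r P(r) E\<^sub>r\<close>, while \<open>y(0) = \<Sum> \<alpha>\<^sub>r\<close> and \<open>y'(0) = \<Sum> \<alpha>\<^sub>r r\<^sup>2\<close> (lemma
  \<open>exp_erfc_sum_solution\<close>).

  The coefficients come from residues. For the initial values, \<open>r\<close> runs through the roots of \<open>P\<close>, so
  that the sum solves the homogeneous equation. For the forcing, \<open>r\<close> also runs through the fourth
  roots of \<open>-\<omega>\<^sup>2\<close>, where \<open>E\<^sub>r + E\<^bsub>-r\<^esub> = 2 exp (r\<^sup>2 t)\<close> with \<open>r\<^sup>2 = \<plusminus>i\<omega>\<close> produces the sine, and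
  \<open>\<alpha>\<^sub>r = \<Omega> \<omega> r / Q'(r)\<close> with \<open>Q = P (X\<^sup>4 + \<omega>\<^sup>2)\<close>. All the conditions on power sums of \<open>\<alpha>\<close> are
  instances of the classical evaluation of \<open>\<Sum> p(r)/Q'(r)\<close> over the roots of \<open>Q\<close>, or of the same sum for \<open>P\<close> (lemma
  \<open>sum_over_roots_div_pderiv\<close>). The terms at the fourth roots of \<open>-\<omega>\<^sup>2\<close> are rewritten with the
  partial fraction expansion of \<open>1/P\<close>, which gives the constants \<open>B\<^sub>m\<close>; the part of \<open>E\<^sub>r\<close> that is odd
  in \<open>r\<close> gives the Fresnel integrals (lemmas \<open>inverse_bt_poly_at_pole\<close>, \<open>erf_eq_fresnel\<close>).

  Uniqueness: if \<open>w\<close> is the difference of two solutions and \<open>f = w''\<close>, then \<open>w\<close> is controlled by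
  \<open>\<integral>\<bar>f\<bar>\<close>, so the equation gives
  \<open>\<bar>f(t)\<bar> \<le> C \<integral>\<^sub>0\<^sup>t \<bar>f(\<tau>)\<bar>/\<surd>(t - \<tau>) d\<tau>\<close>. In the norm \<open>\<integral> \<bar>f(t)\<bar> exp (- \<mu> t) dt\<close> the right-hand
  side is a contraction for large \<open>\<mu>\<close>, hence \<open>f = 0\<close> almost everywhere and \<open>w = 0\<close>. The same fact
  shows that the formula is real: its imaginary part solves the homogeneous problem with zero data.

  That the radicals are the roots of \<open>P\<close> is Ferrari's factorisation with Cardano's solution of the
  resolvent cubic. The principal branches matter twice: the cube roots of the various multiples of
  \<open>\<delta>\<close> have to be compatible, and \<open>R\<close> must not vanish (lemmas \<open>powr_third_scale\<close>,
  \<open>resolvent_root_nonzero\<close>).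
\<close>

section \<open>Interpolation at the simple roots of a polynomial\<close>

text \<open>The quotient \<open>P / (X - z)\<close> vanishes at the roots other than \<open>z\<close> and has the value \<open>P'(z)\<close> at
  \<open>z\<close>, so the right-hand side interpolates \<open>p\<close> at \<open>degree P\<close> points. Having as many distinct roots as
  the degree is the form in which simplicity of the roots is assumed.\<close>

lemma lagrange_at_roots:
  fixes P p :: "complex poly"
  assumes card: "card {z. poly P z = 0} = degree P" and deg: "degree p < degree P"
  shows "p = (\<Sum>z | poly P z = 0. smult (poly p z / poly (pderiv P) z) (synthetic_div P z))"
proof -
  define A where "A = {z. poly P z = 0}"
  have P: "P \<noteq> 0" using deg by auto
  then have fin: "finite A" unfolding A_def by (rule poly_roots_finite)
  have split: "P = [:-z, 1:] * synthetic_div P z" if "z \<in> A" for z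
    using synthetic_div_correct'[of z P] that by (simp add: A_def)
  have deriv: "poly (pderiv P) z = poly (synthetic_div P z) z" if "z \<in> A" for z
  proof -
    have "pderiv P = pderiv ([:-z, 1:] * synthetic_div P z)"
      using split[OF that] by simp
    then show ?thesis by (simp add: pderiv_mult pderiv_pCons del: mult_pCons_left)
  qed
  have cross: "poly (synthetic_div P z) w = 0" if "z \<in> A" "w \<in> A" "w \<noteq> z" for z w
  proof -
    have "0 = poly ([:-z, 1:] * synthetic_div P z) w"
      using split[OF that(1)] that(2) by (simp add: A_def del: mult_pCons_left)
    then show ?thesis using that(3) by simp
  qed
  \<comment> \<open>A double root \<open>z\<close> would leave \<open>P / (X - z)\<close>, of degree one less, with as many roots as \<open>P\<close>.\<close>
  have simple: "poly (pderiv P) z \<noteq> 0" if "z \<in> A" for z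
  proof
    assume "poly (pderiv P) z = 0"
    then have "A \<subseteq> {w. poly (synthetic_div P z) w = 0}"
      using cross[OF that] deriv[OF that] by auto
    moreover have "synthetic_div P z \<noteq> 0"
      using deg by (simp add: synthetic_div_eq_0_iff)
    ultimately have "card A \<le> degree (synthetic_div P z)"
      by (metis (no_types) card_mono card_poly_roots_bound le_trans poly_roots_finite)
    then show False using card deg by (simp add: A_def degree_synthetic_div)
  qed
  have "p = (\<Sum>z\<in>A. smult (poly p z / poly (pderiv P) z) (synthetic_div P z))"
  proof (rule poly_eqI_degree[where A = A])
    fix w assume w: "w \<in> A"
    have "poly (\<Sum>z\<in>A. smult (poly p z / poly (pderiv P) z) (synthetic_div P z)) w
        = (\<Sum>z\<in>A. if z = w then poly p w else 0)"
      unfolding poly_sum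
      by (rule sum.cong) (auto simp: cross w simple deriv[symmetric])
    then show "poly p w = poly (\<Sum>z\<in>A. smult (poly p z / poly (pderiv P) z) (synthetic_div P z)) w"
      using w fin by simp
  next
    show "degree p < card A" using card deg by (simp add: A_def)
    have "degree (\<Sum>z\<in>A. smult (poly p z / poly (pderiv P) z) (synthetic_div P z)) \<le> degree P - 1"
      by (rule degree_sum_le[OF fin])
        (metis degree_smult_le degree_synthetic_div)
    then show "degree (\<Sum>z\<in>A. smult (poly p z / poly (pderiv P) z) (synthetic_div P z)) < card A"
      using card deg by (simp add: A_def)
  qed
  then show ?thesis by (simp add: A_def)
qed

lemma partial_fractions_at_roots:
  fixes P p :: "complex poly"
  assumes "card {z. poly P z = 0} = degree P" and "degree p < degree P" and x: "poly P x \<noteq> 0"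
  shows "poly p x / poly P x = (\<Sum>z | poly P z = 0. poly p z / (poly (pderiv P) z * (x - z)))"
proof -
  have div: "poly (synthetic_div P z) x = poly P x / (x - z)" if "poly P z = 0" for z
  proof -
    have "poly P x = poly ([:-z, 1:] * synthetic_div P z + [:poly P z:]) x"
      by (simp only: synthetic_div_correct')
    then have "poly P x = (x - z) * poly (synthetic_div P z) x"
      using that by (simp add: algebra_simps)
    moreover have "x \<noteq> z" using x that by auto
    ultimately show ?thesis by simp
  qed
  have "poly p x = (\<Sum>z | poly P z = 0. poly p z / poly (pderiv P) z * poly (synthetic_div P z) x)"
    by (subst lagrange_at_roots[OF assms(1,2)]) (simp add: poly_sum)
  also have "\<dots> = (\<Sum>z | poly P z = 0. poly p z / (poly (pderiv P) z * (x - z))) * poly P x"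
    unfolding sum_distrib_right by (rule sum.cong) (auto simp: div)
  finally show ?thesis using x by simp
qed

lemma coeff_synthetic_div_top:
  assumes "degree P \<noteq> 0"
  shows "coeff (synthetic_div P z) (degree P - 1) = lead_coeff P"
  using assms
proof (induction P)
  case (pCons a P)
  show ?case
  proof (cases "degree P")
    case 0
    then obtain d where "P = [:d:]" by (rule degree_eq_zeroE)
    then show ?thesis using pCons.prems by (auto split: if_splits)
  next
    case (Suc n)
    then show ?thesis using pCons.IH by (auto simp: degree_pCons_eq_if)
  qed
qed simp

text \<open>Comparison of the coefficients of highest degree in the interpolation formula. This evaluates
  all the power sums of residues on which the solution formulas depend.\<close>

lemma sum_over_roots_div_pderiv:
  fixes P p :: "complex poly"
  assumes "card {z. poly P z = 0} = degree P" and "degree p < degree P"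
  shows "(\<Sum>z | poly P z = 0. poly p z / poly (pderiv P) z) = coeff p (degree P - 1) / lead_coeff P"
proof -
  have "coeff p (degree P - 1) =
      (\<Sum>z | poly P z = 0. poly p z / poly (pderiv P) z * coeff (synthetic_div P z) (degree P - 1))"
    by (subst lagrange_at_roots[OF assms]) (simp add: coeff_sum)
  also have "\<dots> = (\<Sum>z | poly P z = 0. poly p z / poly (pderiv P) z) * lead_coeff P"
    unfolding sum_distrib_right by (subst coeff_synthetic_div_top) (use assms(2) in auto)
  finally show ?thesis using assms(2) by (auto simp: field_simps)
qed

section \<open>The quartic and its roots in radicals\<close>

text \<open>Each of \<open>a = 0\<close> and \<open>c = 0\<close> would leave at most three distinct roots, or infinitely many, whose
  cardinality counts as zero.\<close>

lemma bt_poly_coeffs_nonzero: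
  assumes "card {z. poly (bt_poly a b c) z = 0} = 4"
  shows "a \<noteq> 0" and "c \<noteq> 0"
proof -
  have nz: "bt_poly a b c \<noteq> 0"
  proof
    assume "bt_poly a b c = 0"
    then have "infinite {z. poly (bt_poly a b c) z = 0}"
      by (simp add: infinite_UNIV_char_0)
    then show False using assms by simp
  qed
  show "a \<noteq> 0"
  proof
    assume "a = 0"
    then have "degree (bt_poly a b c) \<le> 3" by (simp add: bt_poly_def)
    then show False using card_poly_roots_bound[OF nz] assms by simp
  qed
  show "c \<noteq> 0"
  proof
    assume "c = 0"
    have "{z. poly (bt_poly a b c) z = 0} \<subseteq> {0, - of_real b / of_real a}"
    proof (intro subsetI)
      fix z assume "z \<in> {z. poly (bt_poly a b c) z = 0}"
      then have "z ^ 3 * (of_real a * z + of_real b) = 0"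
        using \<open>c = 0\<close> by (simp add: bt_poly_def algebra_simps power3_eq_cube)
      then have "z = 0 \<or> of_real a * z + of_real b = 0"
        unfolding mult_eq_0_iff by simp
      then show "z \<in> {0, - of_real b / of_real a}"
        using \<open>a \<noteq> 0\<close> by (auto simp: field_simps add_eq_0_iff)
    qed
    then have "card {z. poly (bt_poly a b c) z = 0} \<le> card {0, - complex_of_real b / of_real a}"
      by (intro card_mono) auto
    also have "\<dots> \<le> 2" by (simp add: card_insert_if)
    finally show False using assms by simp
  qed
qed

lemma powr_third_cubed: "(z powr (1/3)) ^ 3 = (z :: complex)"
proof (cases "z = 0")
  case False
  then show ?thesis by (simp add: powr_def flip: exp_of_nat_mult)
qed simp

text \<open>Positive factors may be pulled out of a principal cube root; in general
  \<open>(x y)\<^bsup>1/3\<^esup>\<close> and \<open>x\<^bsup>1/3\<^esup> y\<^bsup>1/3\<^esup>\<close> differ by a cube root of unity.\<close>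

lemma powr_third_scale:
  assumes "x > 0"
  shows "(of_real (x ^ 3) * z) powr (1/3) = of_real x * (z :: complex) powr (1/3)"
proof (cases "z = 0")
  case False
  have "Ln (of_real (x ^ 3) * z) = of_real (ln (x ^ 3)) + Ln z"
    using assms False by (subst Ln_times_of_real) (simp_all del: of_real_power add: Ln_of_real)
  also have "of_real (ln (x ^ 3)) = 3 * complex_of_real (ln x)"
    using assms by (simp add: ln_realpow)
  finally show ?thesis
    using assms False by (simp add: powr_def exp_add distrib_left add_divide_distrib exp_of_real)
qed simp

text \<open>The principal cube root divides the argument by three, so the square of the cube root of a
  point with argument in \<open>(0, \<pi>]\<close> has its argument in \<open>(0, 2\<pi>/3]\<close>.\<close>

lemma Im_square_powr_third_pos:
  assumes "Im z > 0 \<or> (Im z = 0 \<and> Re z < 0)"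
  shows "Im ((z powr (1/3))\<^sup>2) > 0"
proof -
  have z: "z \<noteq> 0" using assms by auto
  have "0 < Im (Ln z) \<and> Im (Ln z) \<le> pi"
    using assms Im_Ln_pos_lt[OF z] Im_Ln_eq_pi[OF z] by fastforce
  then have "sin (2 / 3 * Im (Ln z)) > 0"
    by (intro sin_gt_zero) auto
  moreover have "(z powr (1/3))\<^sup>2 = exp (of_real (2/3) * Ln z)"
    using z by (simp add: powr_def flip: exp_double)
  then have "Im ((z powr (1/3))\<^sup>2) = exp (2/3 * Re (Ln z)) * sin (2/3 * Im (Ln z))"
    by (simp only: Im_exp Re_complex_of_real) simp
  ultimately show ?thesis by simp
qed

text \<open>Ferrari's factorisation. If \<open>m\<close> solves the resolvent cubic, then with \<open>4R\<^sup>2 = \<beta>\<^sup>2/4 + m\<close>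
  the quartic splits into the two quadratics whose roots are \<open>-\<beta>/4 \<plusminus> R\<close> shifted by
  \<open>\<plusminus>T\<close>. The term \<open>\<beta>\<^sup>3/(8R)\<close> in \<open>T\<close> is what the linear coefficient demands, and the resolvent
  cubic is what the constant coefficient demands.\<close>

lemma ferrari_factorisation:
  fixes \<beta> \<gamma> m R T1 T2 z :: complex
  assumes m: "m ^ 3 = 4 * \<gamma> * m + \<beta>\<^sup>2 * \<gamma>" and R: "4 * R\<^sup>2 = (\<beta>/2)\<^sup>2 + m" "R \<noteq> 0"
    and T1: "4 * T1\<^sup>2 = \<beta>\<^sup>2 / 2 - m - \<beta>^3 / (8 * R)"
    and T2: "4 * T2\<^sup>2 = \<beta>\<^sup>2 / 2 - m + \<beta>^3 / (8 * R)"
  shows "z ^ 4 + \<beta> * z ^ 3 + \<gamma> =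
    (z - (-\<beta>/4 + R + T1)) * (z - (-\<beta>/4 - R + T2)) *
    (z - (-\<beta>/4 + R - T1)) * (z - (-\<beta>/4 - R - T2))"
proof -
  define S where "S = inverse R"
  have S: "S * R = 1" using R by (simp add: S_def)
  define x where "x = z + \<beta>/4"
  define k where "k = \<beta>^3 * S / 32"
  have kR: "k * R = \<beta>^3 / 32" using S by (simp add: k_def mult.assoc)
  have m': "m = 4 * R\<^sup>2 - (\<beta>/2)\<^sup>2" using R by simp
  have T1': "T1\<^sup>2 = (\<beta>\<^sup>2 / 2 - m) / 4 - k"
    using T1 by (simp add: k_def S_def field_simps)
  have T2': "T2\<^sup>2 = (\<beta>\<^sup>2 / 2 - m) / 4 + k"
    using T2 by (simp add: k_def S_def field_simps)
  have "R\<^sup>2 * ((2 * R\<^sup>2 - 3 * \<beta>\<^sup>2 / 16)\<^sup>2 - k\<^sup>2 - (\<gamma> - 3 * \<beta>^4 / 256)) =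
      (m ^ 3 - 4 * \<gamma> * m - \<beta>\<^sup>2 * \<gamma>) / 16 + ((\<beta>^3 / 32)\<^sup>2 - (k * R)\<^sup>2)"
  proof -
    define w where "w = \<beta> / 4"
    have w: "\<beta> = 4 * w" by (simp add: w_def)
    define q where "q = R\<^sup>2 - w\<^sup>2"
    have "R\<^sup>2 * ((2 * R\<^sup>2 - 3 * w\<^sup>2)\<^sup>2 - k\<^sup>2 - (\<gamma> - 3 * w^4)) =
        4 * q ^ 3 - \<gamma> * q - w\<^sup>2 * \<gamma> + ((2 * w^3)\<^sup>2 - (k * R)\<^sup>2)"
      unfolding q_def by algebra
    moreover have "m = 4 * q" using m' by (simp add: q_def w power2_eq_square)
    ultimately show ?thesis by (simp add: w power_mult_distrib)
  qed
  then have "R\<^sup>2 * ((2 * R\<^sup>2 - 3 * \<beta>\<^sup>2 / 16)\<^sup>2 - k\<^sup>2 - (\<gamma> - 3 * \<beta>^4 / 256)) = 0"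
    by (simp add: kR m)
  then have const: "(2 * R\<^sup>2 - 3 * \<beta>\<^sup>2 / 16)\<^sup>2 - k\<^sup>2 = \<gamma> - 3 * \<beta>^4 / 256"
    using R by simp
  have quads: "(p - T1) * (q - T2) * (p + T1) * (q + T2) = (p\<^sup>2 - T1\<^sup>2) * (q\<^sup>2 - T2\<^sup>2)" for p q
    by (simp add: power2_eq_square algebra_simps)
  have "(z - (-\<beta>/4 + R + T1)) * (z - (-\<beta>/4 - R + T2)) *
    (z - (-\<beta>/4 + R - T1)) * (z - (-\<beta>/4 - R - T2))
     = (x - R - T1) * (x + R - T2) * (x - R + T1) * (x + R + T2)"
    by (simp add: x_def algebra_simps)
  also have "\<dots> = ((x - R)\<^sup>2 - T1\<^sup>2) * ((x + R)\<^sup>2 - T2\<^sup>2)"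
    by (rule quads)
  also have "\<dots> = ((x\<^sup>2 + (2 * R\<^sup>2 - 3 * \<beta>\<^sup>2 / 16)) - (2 * R * x - k)) *
      ((x\<^sup>2 + (2 * R\<^sup>2 - 3 * \<beta>\<^sup>2 / 16)) + (2 * R * x - k))"
    unfolding T1' T2' m' by (intro arg_cong2[where f = "(*)"]; simp add: power2_eq_square field_simps)
  also have "\<dots> = (x\<^sup>2 + (2 * R\<^sup>2 - 3 * \<beta>\<^sup>2 / 16))\<^sup>2 - (2 * R * x - k)\<^sup>2"
    by (simp add: power2_eq_square algebra_simps)
  also have "\<dots> = x^4 - 3 * \<beta>\<^sup>2 / 8 * x\<^sup>2 + 4 * (k * R) * x + ((2 * R\<^sup>2 - 3 * \<beta>\<^sup>2 / 16)\<^sup>2 - k\<^sup>2)"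
  proof -
    have "(x\<^sup>2 + e)\<^sup>2 - (2 * R * x - k)\<^sup>2 = x^4 + (2 * e - 4 * R\<^sup>2) * x\<^sup>2 + 4 * (k * R) * x + (e\<^sup>2 - k\<^sup>2)" for e
      by algebra
    then show ?thesis by simp
  qed
  also have "\<dots> = x^4 - 3 * \<beta>\<^sup>2 / 8 * x\<^sup>2 + \<beta>^3 / 8 * x + (\<gamma> - 3 * \<beta>^4 / 256)"
    by (simp only: const kR) simp
  also have "\<dots> = z ^ 4 + \<beta> * z ^ 3 + \<gamma>"
  proof -
    define w where "w = \<beta> / 4"
    have "(z + w) ^ 4 + (8 * w ^ 3 * (z + w) - 3 * w ^ 4 - 6 * w\<^sup>2 * (z + w)\<^sup>2) = z ^ 4 + 4 * w * z ^ 3"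
      by algebra
    moreover have "\<beta> = 4 * w" "x = z + w" by (simp_all add: w_def x_def)
    ultimately show ?thesis by (simp add: power_mult_distrib)
  qed
  finally show ?thesis by simp
qed

text \<open>The cube roots of the multiples of \<open>\<delta>\<close> are positive real multiples of the single root
  \<open>u = (\<delta>/18)\<^bsup>1/3\<^esup>\<close>, so the radicands depend on \<open>m = u + 4\<gamma>/(3u)\<close> alone, and this is Cardano's solution of the
  resolvent cubic.\<close>

lemma cardano_resolvent_root:
  fixes \<beta> \<gamma> :: complex
  assumes "\<gamma> \<noteq> 0"
  obtains u m where "u = (bt_delta \<beta> \<gamma> / 18) powr (1/3)" "u \<noteq> 0" "m = u + 4 * \<gamma> / (3 * u)"
    "m ^ 3 = 4 * \<gamma> * m + \<beta>\<^sup>2 * \<gamma>"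
    "bt_R \<beta> \<gamma> = 1/2 * csqrt ((\<beta>/2)\<^sup>2 + m)"
    "\<And>\<sigma>. bt_T \<sigma> \<beta> \<gamma> = 1/2 * csqrt (\<beta>\<^sup>2 / 2 - m - \<sigma> * (\<beta>^3 / (8 * bt_R \<beta> \<gamma>)))"
proof -
  define \<delta> where "\<delta> = bt_delta \<beta> \<gamma>"
  define u where "u = (\<delta> / 18) powr (1/3)"
  define m where "m = u + 4 * \<gamma> / (3 * u)"
  have quad: "\<delta>\<^sup>2 - 18 * \<beta>\<^sup>2 * \<gamma> * \<delta> + 768 * \<gamma> ^ 3 = 0"
  proof -
    have "\<delta>\<^sup>2 - 18 * \<beta>\<^sup>2 * \<gamma> * \<delta> + 768 * \<gamma> ^ 3 =
        \<gamma>\<^sup>2 * ((csqrt (81 * \<beta>^4 - 768 * \<gamma>))\<^sup>2 - (81 * \<beta>^4 - 768 * \<gamma>))"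
      unfolding \<delta>_def bt_delta_def by algebra
    then show ?thesis by simp
  qed
  have "\<delta> \<noteq> 0" using quad assms by auto
  then have u: "u \<noteq> 0" by (simp add: u_def)
  have u3: "u ^ 3 = \<delta> / 18" unfolding u_def by (rule powr_third_cubed)
  have r12: "(12 * \<delta>) powr (1/3) = 6 * u"
    using powr_third_scale[of 6 "\<delta> / 18"] by (simp add: u_def)
  have "(2::complex) powr (1/3) / (3 * \<delta>) powr (1/3) = 1 / (3 * u)"
  proof -
    have "(3 * \<delta>) powr (1/3) = (27 * (2 * (\<delta> / 18))) powr (1/3)"
      by simp
    also have "\<dots> = 3 * (2 * (\<delta> / 18)) powr (1/3)"
      using powr_third_scale[of 3 "2 * (\<delta> / 18)"] by simp
    also have "(2 * (\<delta> / 18)) powr (1/3) = 2 powr (1/3) * u"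
    proof -
      have "complex_of_real ((2 powr (1/3)) ^ 3) = 2"
        by (simp add: powr_realpow[symmetric] powr_powr)
      moreover have "(2::complex) powr (1/3) = of_real (2 powr (1/3))"
        using powr_of_real[of 2 "1/3"] by simp
      ultimately show ?thesis
        using powr_third_scale[of "2 powr (1/3)" "\<delta> / 18"] by (simp add: u_def)
    qed
    finally show ?thesis by (simp add: field_simps)
  qed
  then have rT: "4 * \<gamma> * (2 powr (1/3) / (3 * \<delta>) powr (1/3)) = 4 * \<gamma> / (3 * u)" by simp
  have "m ^ 3 = 4 * \<gamma> * m + \<beta>\<^sup>2 * \<gamma>"
  proof -
    define v where "v = 4 * \<gamma> / (3 * u)"
    have uv: "3 * (u * v) = 4 * \<gamma>" using u by (simp add: v_def)
    have "u * v = 4 * \<gamma> / 3" using uv by (simp add: field_simps)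
    then have "(u * v) ^ 3 = (4 * \<gamma> / 3) ^ 3" by (simp only:)
    then have "(u * v) ^ 3 = 64 * \<gamma> ^ 3 / 27" by (simp only: power_divide power_mult_distrib) simp
    then have uv3: "u ^ 3 * v ^ 3 = 64 * \<gamma> ^ 3 / 27" by (simp only: power_mult_distrib)
    have "u ^ 3 * (u ^ 3 + v ^ 3 - \<beta>\<^sup>2 * \<gamma>) = (u ^ 3)\<^sup>2 + u ^ 3 * v ^ 3 - \<beta>\<^sup>2 * \<gamma> * u ^ 3"
      by algebra
    also have "\<dots> = (\<delta>\<^sup>2 - 18 * \<beta>\<^sup>2 * \<gamma> * \<delta> + 768 * \<gamma> ^ 3) / 324"
      unfolding uv3 unfolding u3 by (simp add: power2_eq_square field_simps)
    also have "\<dots> = 0" using quad by simp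
    finally have "u ^ 3 * (u ^ 3 + v ^ 3 - \<beta>\<^sup>2 * \<gamma>) = 0" .
    then have "u ^ 3 + v ^ 3 = \<beta>\<^sup>2 * \<gamma>" using u by simp
    moreover have "(u + v) ^ 3 = u ^ 3 + v ^ 3 + 3 * (u * v) * (u + v)" by algebra
    ultimately have "(u + v) ^ 3 = \<beta>\<^sup>2 * \<gamma> + 4 * \<gamma> * (u + v)" by (simp only: uv)
    then show ?thesis unfolding m_def v_def by (simp only: add.commute)
  qed
  moreover have "8 * \<gamma> / (6 * u) = 4 * \<gamma> / (3 * u)" by (simp add: field_simps)
  then have "bt_R \<beta> \<gamma> = 1/2 * csqrt ((\<beta>/2)\<^sup>2 + m)"
    unfolding bt_R_def Let_def \<delta>_def[symmetric] u_def[symmetric] r12 m_def by (simp only: add.assoc)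
  moreover have "bt_T \<sigma> \<beta> \<gamma> = 1/2 * csqrt (\<beta>\<^sup>2 / 2 - m - \<sigma> * (\<beta>^3 / (8 * bt_R \<beta> \<gamma>)))" for \<sigma>
  proof -
    have "x - 4 * \<gamma> / (3 * u) - u = x - m" for x by (simp add: m_def)
    then show ?thesis
      unfolding bt_T_def Let_def \<delta>_def[symmetric] u_def[symmetric] rT by (simp only:)
  qed
  ultimately show ?thesis
    using that[of u m] u unfolding u_def \<delta>_def m_def by blast
qed

text \<open>For \<open>\<beta> = 0\<close> and real \<open>\<gamma> = x\<close>, the number \<open>\<delta>\<close> is a positive multiple of \<open>\<i>\<close> or a negative real
  number. In both cases \<open>u\<^sup>2\<close> is not real, whereas \<open>u + 4x/(3u) = 0\<close> would make it real. For
  one of the other two cube roots the sum does vanish.\<close>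

lemma resolvent_root_nonzero:
  fixes x :: real
  assumes "x \<noteq> 0" and u: "u = (bt_delta 0 (of_real x) / 18) powr (1/3)"
  shows "u + 4 * of_real x / (3 * u) \<noteq> 0"
proof
  assume eq: "u + 4 * of_real x / (3 * u) = 0"
  have "bt_delta 0 (of_real x) = csqrt (of_real (- 768 * x)) * of_real x"
    by (simp add: bt_delta_def)
  then have "Im (bt_delta 0 (of_real x) / 18) > 0 \<or>
      (Im (bt_delta 0 (of_real x) / 18) = 0 \<and> Re (bt_delta 0 (of_real x) / 18) < 0)"
    using assms(1) unfolding csqrt_of_real'
    by (cases "x > 0") (auto simp: zero_less_mult_iff mult_less_0_iff)
  then have "Im (u\<^sup>2) > 0" unfolding u by (rule Im_square_powr_third_pos)
  moreover have "u \<noteq> 0"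
    using calculation by auto
  then have "u\<^sup>2 = of_real (- (4 * x / 3))"
    using eq by (simp add: field_simps power2_eq_square eq_neg_iff_add_eq_0)
  ultimately show False by simp
qed

text \<open>If \<open>R\<close> vanished then \<open>m = -\<beta>\<^sup>2/4\<close>, and the resolvent cubic would force \<open>\<beta> = 0\<close> and
  \<open>m = 0\<close>, which the choice of the principal branches excludes. So Ferrari's factorisation
  applies.\<close>

lemma bt_poly_factorisation:
  assumes a: "a \<noteq> 0" and c: "c \<noteq> 0"
  shows "poly (bt_poly a b c) z = of_real a * (\<Prod>k=1..4. z - bt_root a b c k)"
proof -
  define \<beta> \<gamma> where "\<beta> = complex_of_real (b / a)" and "\<gamma> = complex_of_real (c / a)"
  have "\<gamma> \<noteq> 0" using a c by (simp add: \<gamma>_def)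
  then obtain u m where u: "u = (bt_delta \<beta> \<gamma> / 18) powr (1/3)" "u \<noteq> 0"
    and m: "m = u + 4 * \<gamma> / (3 * u)" "m ^ 3 = 4 * \<gamma> * m + \<beta>\<^sup>2 * \<gamma>"
    and R: "bt_R \<beta> \<gamma> = 1/2 * csqrt ((\<beta>/2)\<^sup>2 + m)"
    and T: "\<And>\<sigma>. bt_T \<sigma> \<beta> \<gamma> = 1/2 * csqrt (\<beta>\<^sup>2 / 2 - m - \<sigma> * (\<beta>^3 / (8 * bt_R \<beta> \<gamma>)))"
    by (rule cardano_resolvent_root[where \<beta> = \<beta>]) blast
  have R0: "bt_R \<beta> \<gamma> \<noteq> 0"
  proof
    assume "bt_R \<beta> \<gamma> = 0"
    then have "(\<beta>/2)\<^sup>2 + m = 0" using R by simp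
    then have m4: "m = - (\<beta>\<^sup>2 / 4)" by (simp add: power2_eq_square add_eq_0_iff)
    have "(- (\<beta>\<^sup>2 / 4)) ^ 3 = 0"
      using m(2) unfolding m4 by simp
    then have "\<beta> = 0" by simp
    then have "m \<noteq> 0"
      using resolvent_root_nonzero[of "c / a" u] u(1) m(1) a c by (simp add: \<gamma>_def)
    then show False using m4 \<open>\<beta> = 0\<close> by simp
  qed
  have "z ^ 4 + \<beta> * z ^ 3 + \<gamma> =
    (z - (-\<beta>/4 + bt_R \<beta> \<gamma> + bt_T 1 \<beta> \<gamma>)) * (z - (-\<beta>/4 - bt_R \<beta> \<gamma> + bt_T (-1) \<beta> \<gamma>)) *
    (z - (-\<beta>/4 + bt_R \<beta> \<gamma> - bt_T 1 \<beta> \<gamma>)) * (z - (-\<beta>/4 - bt_R \<beta> \<gamma> - bt_T (-1) \<beta> \<gamma>))"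
  proof (rule ferrari_factorisation[OF m(2) _ R0])
    show "4 * (bt_R \<beta> \<gamma>)\<^sup>2 = (\<beta>/2)\<^sup>2 + m" by (simp add: R power_divide)
    show "4 * (bt_T 1 \<beta> \<gamma>)\<^sup>2 = \<beta>\<^sup>2 / 2 - m - \<beta> ^ 3 / (8 * bt_R \<beta> \<gamma>)"
      and "4 * (bt_T (-1) \<beta> \<gamma>)\<^sup>2 = \<beta>\<^sup>2 / 2 - m + \<beta> ^ 3 / (8 * bt_R \<beta> \<gamma>)"
      by (simp_all add: T power_divide)
  qed
  moreover have "{1..4::nat} = {1, 2, 3, 4}" by auto
  then have "(\<Prod>k=1..4. z - bt_root a b c k) =
    (z - (-\<beta>/4 + bt_R \<beta> \<gamma> + bt_T 1 \<beta> \<gamma>)) * (z - (-\<beta>/4 - bt_R \<beta> \<gamma> + bt_T (-1) \<beta> \<gamma>)) *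
    (z - (-\<beta>/4 + bt_R \<beta> \<gamma> - bt_T 1 \<beta> \<gamma>)) * (z - (-\<beta>/4 - bt_R \<beta> \<gamma> - bt_T (-1) \<beta> \<gamma>))"
    by (simp add: bt_root_def Let_def mult.assoc 
        flip: \<beta>_def \<gamma>_def del: of_real_divide)
  moreover have "poly (bt_poly a b c) z = of_real a * (z ^ 4 + \<beta> * z ^ 3 + \<gamma>)"
    using a by (simp add: bt_poly_def \<beta>_def \<gamma>_def field_simps power3_eq_cube power4_eq_xxxx)
  ultimately show ?thesis by simp
qed

lemma bij_betw_bt_root:
  assumes four: "card {z. poly (bt_poly a b c) z = 0} = 4"
  shows "bij_betw (bt_root a b c) {1..4} {z. poly (bt_poly a b c) z = 0}"
proof -
  note ac = bt_poly_coeffs_nonzero[OF four]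
  have roots: "{z. poly (bt_poly a b c) z = 0} = bt_root a b c ` {1..4}"
    using ac(1) by (auto simp: bt_poly_factorisation[OF ac])
  then have "inj_on (bt_root a b c) {1..4}"
    using four by (intro eq_card_imp_inj_on) auto
  then show ?thesis using roots by (simp add: bij_betw_def)
qed

section \<open>Half-order integration of \<open>exp (r\<^sup>2 t) erfc (- r \<surd>t)\<close>\<close>

lemma has_field_derivative_line_integral:
  assumes "f holomorphic_on UNIV"
  shows "((\<lambda>z. contour_integral (linepath 0 z) f) has_field_derivative f z) (at z)"
proof -
  obtain g where g: "\<And>z. (g has_field_derivative f z) (at z)"
    using holomorphic_convex_primitive'[of UNIV f] assms by auto
  have "contour_integral (linepath 0 z) f = g z - g 0" for z
    using contour_integral_primitive[of UNIV g f "linepath 0 z"] g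
    by (intro contour_integral_unique) auto
  then show ?thesis
    using DERIV_diff[OF g DERIV_const] by simp
qed

lemma erfc_has_field_derivative:
  "(erfc has_field_derivative - 2 / of_real (sqrt pi) * exp (- (z\<^sup>2))) (at z)"
proof -
  have "((\<lambda>z. contour_integral (linepath 0 z) (\<lambda>u. exp (- (u\<^sup>2)))) has_field_derivative
      exp (- (z\<^sup>2))) (at z)"
    by (rule has_field_derivative_line_integral) (intro holomorphic_intros)
  then show ?thesis
    unfolding erfc_def by (auto intro!: derivative_eq_intros)
qed

lemma erfc_0 [simp]: "erfc 0 = 1"
  by (simp add: erfc_def)

text \<open>The entire function of \<open>x\<close> whose value at \<open>x = \<surd>t\<close> is \<open>exp (r\<^sup>2 t) erfc (- r \<surd>t)\<close>. The
  substitution \<open>t = x\<^sup>2\<close> removes the singularity of the derivative at \<open>t = 0\<close>.\<close>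

definition exp_erfc :: "complex \<Rightarrow> complex \<Rightarrow> complex" where
  "exp_erfc r x = exp (r\<^sup>2 * x\<^sup>2) * erfc (- r * x)"

lemma exp_erfc_0 [simp]: "exp_erfc r 0 = 1"
  by (simp add: exp_erfc_def)

lemma exp_erfc_has_field_derivative [derivative_intros]:
  "(exp_erfc r has_field_derivative 2 * r\<^sup>2 * x * exp_erfc r x + 2 * r / of_real (sqrt pi)) (at x)"
proof -
  have inner: "((\<lambda>x. - r * x) has_field_derivative - r) (at x)"
    by (auto intro!: derivative_eq_intros)
  have erfc: "((\<lambda>x. erfc (- r * x)) has_field_derivative
      - 2 / of_real (sqrt pi) * exp (- ((- r * x)\<^sup>2)) * - r) (at x)"
    by (rule DERIV_chain2[OF erfc_has_field_derivative inner])
  have ex: "((\<lambda>x. exp (r\<^sup>2 * x\<^sup>2)) has_field_derivative exp (r\<^sup>2 * x\<^sup>2) * (2 * r\<^sup>2 * x)) (at x)"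
    by (auto intro!: derivative_eq_intros)
  have "exp (r\<^sup>2 * x\<^sup>2) * exp (- ((- r * x)\<^sup>2)) = 1"
    by (simp add: power_mult_distrib flip: exp_add)
  then have "exp (r\<^sup>2 * x\<^sup>2) * (2 * r\<^sup>2 * x) * erfc (- r * x) +
      - 2 / of_real (sqrt pi) * exp (- ((- r * x)\<^sup>2)) * - r * exp (r\<^sup>2 * x\<^sup>2) =
      2 * r\<^sup>2 * x * (exp (r\<^sup>2 * x\<^sup>2) * erfc (- r * x)) + 2 * r / of_real (sqrt pi)"
    by (simp add: mult_ac)
  then show ?thesis
    using DERIV_mult[OF ex erfc] unfolding exp_erfc_def by (simp only:)
qed

lemma continuous_on_exp_erfc [continuous_intros]:
  "continuous_on S f \<Longrightarrow> continuous_on S (\<lambda>x. exp_erfc r (f x))"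
  by (rule continuous_on_compose2[of UNIV "exp_erfc r" S f])
    (auto intro: DERIV_continuous_on exp_erfc_has_field_derivative)

text \<open>The substitution \<open>\<tau> = t sin\<^sup>2 \<theta>\<close> turns the weakly singular integral into the integral of a
  continuous function over a compact interval, which settles integrability and makes differentiation
  under the integral sign harmless.\<close>

lemma Abel_kernel_substitution:
  fixes g :: "real \<Rightarrow> real"
  assumes t: "t > 0" and g: "continuous_on {0..sqrt t} g"
  shows "(\<lambda>\<tau>. g (sqrt \<tau>) / sqrt (t - \<tau>)) absolutely_integrable_on {0..t}"
    and "integral {0..t} (\<lambda>\<tau>. g (sqrt \<tau>) / sqrt (t - \<tau>)) =
      integral {0..pi/2} (\<lambda>\<theta>. 2 * sqrt t * (sin \<theta> * g (sqrt t * sin \<theta>)))"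
proof -
  let ?f = "\<lambda>\<tau>. g (sqrt \<tau>) / sqrt (t - \<tau>)"
  let ?G = "\<lambda>\<theta>. 2 * sqrt t * (sin \<theta> * g (sqrt t * sin \<theta>))"
  let ?h = "\<lambda>\<theta>. t * (sin \<theta>)\<^sup>2" and ?h' = "\<lambda>\<theta>. 2 * t * sin \<theta> * cos \<theta>"
  let ?S = "{0<..<pi/2}"
  have sin01: "0 < sin \<theta>" "sin \<theta> < 1" "0 < cos \<theta>" if "\<theta> \<in> ?S" for \<theta>
    using that sin_gt_zero[of \<theta>] cos_gt_zero[of \<theta>] sin_monotone_2pi[of \<theta> "pi/2"] by auto
  have integrand: "\<bar>?h' \<theta>\<bar> * ?f (?h \<theta>) = ?G \<theta>" if "\<theta> \<in> ?S" for \<theta>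
  proof -
    have "sqrt (t - ?h \<theta>) = sqrt (t * (cos \<theta>)\<^sup>2)"
      by (simp add: cos_squared_eq algebra_simps)
    also have "\<dots> = sqrt t * cos \<theta>" using sin01[OF that] by (simp add: real_sqrt_mult)
    finally have "sqrt (t - ?h \<theta>) = sqrt t * cos \<theta>" .
    moreover have "sqrt (?h \<theta>) = sqrt t * sin \<theta>"
      using sin01[OF that] by (simp add: real_sqrt_mult)
    moreover have "t = sqrt t * sqrt t" using t by simp
    ultimately show ?thesis
      using sin01[OF that] t by (simp add: abs_mult field_simps)
  qed
  have inj: "inj_on ?h ?S"
  proof (rule inj_onI)
    fix x y assume xy: "x \<in> ?S" "y \<in> ?S" "?h x = ?h y"
    then have "sin x = sin y"
      using t sin01[OF xy(1)] sin01[OF xy(2)] by (simp add: power2_eq_iff)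
    then show "x = y" using xy sin_inj_pi[of x y] by auto
  qed
  have image: "?h ` ?S = {0<..<t}"
  proof (intro equalityI subsetI)
    fix \<tau> assume "\<tau> \<in> ?h ` ?S"
    then obtain \<theta> where \<theta>: "\<theta> \<in> ?S" "\<tau> = ?h \<theta>" by auto
    have "(sin \<theta>)\<^sup>2 < 1" using sin01[OF \<theta>(1)] by (simp add: power_less_one_iff abs_square_less_1)
    then show "\<tau> \<in> {0<..<t}" using sin01[OF \<theta>(1)] \<theta>(2) t by simp
  next
    fix \<tau> assume \<tau>: "\<tau> \<in> {0<..<t}"
    define s where "s = sqrt (\<tau> / t)"
    have s: "0 < s" "s < 1" using \<tau> t by (auto simp: s_def)
    then have "0 < arcsin s" "arcsin s < pi / 2"
      using arcsin_less_arcsin[of 0 s] arcsin_less_arcsin[of s 1] by auto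
    moreover have "\<tau> = ?h (arcsin s)"
    proof -
      have "sin (arcsin s) = s" using s by (intro sin_arcsin) auto
      moreover have "t * s\<^sup>2 = \<tau>" using \<tau> t by (simp add: s_def)
      ultimately show ?thesis by simp
    qed
    ultimately show "\<tau> \<in> ?h ` ?S" by auto
  qed
  have "continuous_on {0..pi/2} ?G"
  proof -
    have "continuous_on {0..pi/2} (\<lambda>\<theta>. g (sqrt t * sin \<theta>))"
      using t sin_ge_zero by (intro continuous_on_compose2[OF g]) (auto intro!: continuous_intros mult_left_le)
    then show ?thesis by (intro continuous_intros)
  qed
  then have absG: "?G absolutely_integrable_on {0..pi/2}"
    using absolutely_integrable_continuous_real by blast
  then have "?G absolutely_integrable_on ?S"
    by (rule set_integrable_subset) auto
  then have "(\<lambda>\<theta>. \<bar>?h' \<theta>\<bar> * ?f (?h \<theta>)) absolutely_integrable_on ?S"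
    by (rule absolutely_integrable_spike[of _ _ "{}"]) (use integrand in auto)
  moreover have "integral ?S (\<lambda>\<theta>. \<bar>?h' \<theta>\<bar> * ?f (?h \<theta>)) = integral ?S ?G"
    by (rule integral_cong) (rule integrand)
  moreover have "(?h has_field_derivative ?h' \<theta>) (at \<theta> within ?S)" for \<theta>
    by (auto intro!: derivative_eq_intros)
  ultimately have "?f absolutely_integrable_on {0<..<t} \<and> integral {0<..<t} ?f = integral ?S ?G"
    using has_absolute_integral_change_of_variables_1'[of ?S ?h ?h' ?f "integral ?S ?G"] inj image
    by auto
  moreover have "integral ?S ?G = integral {0..pi/2} ?G" "integral {0<..<t} ?f = integral {0..t} ?f"
    by (simp_all add: integral_open_interval_real)
  moreover have "?f absolutely_integrable_on {0<..<t} \<Longrightarrow> ?f absolutely_integrable_on {0..t}"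
    by (erule absolutely_integrable_spike_set; rule negligible_subset[of "{0, t}"]) auto
  ultimately show "?f absolutely_integrable_on {0..t}" "integral {0..t} ?f = integral {0..pi/2} ?G"
    by auto
qed

text \<open>By the substitution above with \<open>x = \<surd>t\<close>, this says that half-order integration maps \<open>E\<^sub>r\<close> to
  \<open>(E\<^sub>r - 1)/r\<close>. Let \<open>K(x)\<close> be the integral and \<open>e\<close> the function \<open>exp_erfc r\<close>, for which
  \<open>e' = 2 r\<^sup>2 x e + 2 r/\<surd>\<pi>\<close>. Integration by parts evaluates \<open>K + x K'\<close> in terms of \<open>K\<close>, and this shows
  that \<open>G = 1 + (2 r/\<surd>\<pi>) x K\<close> satisfies the differential equation of \<open>e\<close>. Since also
  \<open>G(0) = e(0)\<close>, the two functions are equal.\<close>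

lemma integral_sin_exp_erfc:
  fixes r x :: complex
  assumes "r \<noteq> 0"
  shows "2 * r * x * integral {0..pi/2} (\<lambda>\<theta>. of_real (sin \<theta>) * exp_erfc r (x * of_real (sin \<theta>)))
    = of_real (sqrt pi) * (exp_erfc r x - 1)"
proof -
  define e where "e = exp_erfc r"
  define s c :: "real \<Rightarrow> complex" where "s = (\<lambda>\<theta>. of_real (sin \<theta>))" and "c = (\<lambda>\<theta>. of_real (cos \<theta>))"
  define q where "q = complex_of_real (sqrt pi)"
  have q: "q \<noteq> 0" "q * q = of_real pi" by (simp_all add: q_def flip: of_real_mult)
  define e' where "e' x = 2 * r\<^sup>2 * x * e x + 2 * r / q" for x
  have e': "(e has_field_derivative e' x) (at x)" for x
    using exp_erfc_has_field_derivative unfolding e_def e'_def q_def .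
  note [continuous_intros] = continuous_on_exp_erfc[of _ _ r, folded e_def]
  have cs [continuous_intros]: "continuous_on A (\<lambda>z. s (f z))" "continuous_on A (\<lambda>z. c (f z))"
    if "continuous_on A f" for A and f :: "'b::t2_space \<Rightarrow> real"
    unfolding s_def c_def using that by (auto intro!: continuous_intros)
  have ce' [continuous_intros]: "continuous_on A (\<lambda>z. e' (f z))" if "continuous_on A f"
    for A and f :: "'b::t2_space \<Rightarrow> complex"
    unfolding e'_def by (intro continuous_intros that)
  define K where "K x = integral {0..pi/2} (\<lambda>\<theta>. s \<theta> * e (x * s \<theta>))" for x
  define K' where "K' x = integral {0..pi/2} (\<lambda>\<theta>. (s \<theta>)\<^sup>2 * e' (x * s \<theta>))" for x
  have Kderiv: "(K has_field_derivative K' x) (at x)" for x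
  proof -
    have "((\<lambda>x. integral (cbox 0 (pi/2)) (\<lambda>\<theta>. s \<theta> * e (x * s \<theta>))) has_field_derivative
        integral (cbox 0 (pi/2)) (\<lambda>\<theta>. (s \<theta>)\<^sup>2 * e' (x * s \<theta>))) (at x within UNIV)"
    proof (rule leibniz_rule_field_derivative)
      show "((\<lambda>x. s \<theta> * e (x * s \<theta>)) has_field_derivative (s \<theta>)\<^sup>2 * e' (x * s \<theta>)) (at x within UNIV)"
        for x and \<theta> :: real
        by (auto intro!: derivative_eq_intros DERIV_chain2[OF e'] simp: power2_eq_square)
      show "(\<lambda>\<theta>. s \<theta> * e (x * s \<theta>)) integrable_on cbox 0 (pi/2)" for x
        by (intro integrable_continuous continuous_intros)
      show "continuous_on (UNIV \<times> cbox 0 (pi/2)) (\<lambda>(x, \<theta>). (s \<theta>)\<^sup>2 * e' (x * s \<theta>))"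
        unfolding case_prod_beta by (intro continuous_intros)
    qed auto
    then show ?thesis by (simp add: K_def[abs_def] K'_def)
  qed
  have parts: "K x + x * K' x = 1 + 2 * r\<^sup>2 * x\<^sup>2 * K x + r * x * q" for x
  proof -
    \<comment> \<open>Integration by parts, in the form of a product that is differentiated.\<close>
    have "((\<lambda>\<theta>. s \<theta> * e (x * s \<theta>) - x * (c \<theta>)\<^sup>2 * e' (x * s \<theta>)) has_integral
        - c (pi/2) * e (x * s (pi/2)) - (- c 0 * e (x * s 0))) {0..pi/2}"
    proof (rule fundamental_theorem_of_calculus)
      fix \<theta> :: real
      have ds: "(s has_vector_derivative c \<theta>) (at \<theta>)" "(c has_vector_derivative - s \<theta>) (at \<theta>)"
        unfolding s_def c_def
        by (auto intro!: derivative_eq_intros has_vector_derivative_of_real simp flip: of_real_minus)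
      have "((\<lambda>\<theta>. e (x * s \<theta>)) has_vector_derivative (x * c \<theta>) * e' (x * s \<theta>)) (at \<theta>)"
        using field_vector_diff_chain_at[of "\<lambda>\<theta>. x * s \<theta>" "x * c \<theta>" \<theta> e "e' (x * s \<theta>)"] e' ds
        by (auto simp: o_def intro: has_vector_derivative_mult_right)
      then have "((\<lambda>\<theta>. - c \<theta> * e (x * s \<theta>)) has_vector_derivative
          - c \<theta> * ((x * c \<theta>) * e' (x * s \<theta>)) + - (- s \<theta>) * e (x * s \<theta>)) (at \<theta>)"
        using ds by (intro has_vector_derivative_mult has_vector_derivative_minus)
      then show "((\<lambda>\<theta>. - c \<theta> * e (x * s \<theta>)) has_vector_derivative
          s \<theta> * e (x * s \<theta>) - x * (c \<theta>)\<^sup>2 * e' (x * s \<theta>)) (at \<theta> within {0..pi/2})"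
        by (auto intro: has_vector_derivative_at_within simp: power2_eq_square algebra_simps)
    qed auto
    then have "integral {0..pi/2} (\<lambda>\<theta>. s \<theta> * e (x * s \<theta>) - x * (c \<theta>)\<^sup>2 * e' (x * s \<theta>)) = 1"
      by (auto simp: s_def c_def e_def intro!: integral_unique)
    moreover have "integral {0..pi/2} (\<lambda>\<theta>. s \<theta> * e (x * s \<theta>) - x * (c \<theta>)\<^sup>2 * e' (x * s \<theta>)) +
        x * K' x = integral {0..pi/2} (\<lambda>\<theta>. (s \<theta> * e (x * s \<theta>) - x * (c \<theta>)\<^sup>2 * e' (x * s \<theta>)) +
        x * ((s \<theta>)\<^sup>2 * e' (x * s \<theta>)))"
      unfolding K'_def
      by (subst integral_add) (auto intro!: integrable_continuous_interval continuous_intros)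
    moreover have "(s \<theta> * e (x * s \<theta>) - x * (c \<theta>)\<^sup>2 * e' (x * s \<theta>)) + x * ((s \<theta>)\<^sup>2 * e' (x * s \<theta>))
      = s \<theta> * e (x * s \<theta>) - x * e' (x * s \<theta>) + 2 * x * ((s \<theta>)\<^sup>2 * e' (x * s \<theta>))" for \<theta>
    proof -
      have "(c \<theta>)\<^sup>2 = 1 - (s \<theta>)\<^sup>2"
        unfolding c_def s_def by (simp add: cos_squared_eq flip: of_real_power)
      then show ?thesis by (simp only:) (simp add: algebra_simps)
    qed
    ultimately have "1 + x * K' x = integral {0..pi/2} (\<lambda>\<theta>. s \<theta> * e (x * s \<theta>) - x * e' (x * s \<theta>) + 2 * x * ((s \<theta>)\<^sup>2 * e' (x * s \<theta>)))"
      by simp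
    also have "\<dots> = K x - integral {0..pi/2} (\<lambda>\<theta>. x * e' (x * s \<theta>)) + 2 * x * K' x"
      unfolding K_def K'_def
      by (subst integral_add integral_diff; (auto intro!: integrable_continuous_interval continuous_intros)?)+
    also have "integral {0..pi/2} (\<lambda>\<theta>. x * e' (x * s \<theta>)) = 
       integral {0..pi/2} (\<lambda>\<theta>. 2 * r\<^sup>2 * x\<^sup>2 * (s \<theta> * e (x * s \<theta>)) + 2 * r * x / q)"
      by (simp add: e'_def algebra_simps power2_eq_square)
    also have "\<dots> = 2 * r\<^sup>2 * x\<^sup>2 * K x + pi / 2 * (2 * r * x / q)"
      unfolding K_def
      by (subst integral_add) (auto intro!: integrable_continuous_interval continuous_intros simp: scaleR_conv_of_real)
    also have "pi / 2 * (2 * r * x / q) = r * x * q"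
      using q by (simp add: field_simps)
    finally show ?thesis by (simp add: algebra_simps)
  qed
  define G where "G x = 1 + 2 * r / q * (x * K x)" for x
  have G': "(G has_field_derivative 2 * r\<^sup>2 * x * G x + 2 * r / q) (at x)" for x
  proof -
    have "((\<lambda>x. 1 + 2 * r / q * (x * K x)) has_field_derivative 0 + 2 * r / q * (1 * K x + K' x * x)) (at x)"
      by (rule DERIV_add[OF DERIV_const DERIV_cmult[OF DERIV_mult[OF DERIV_ident Kderiv]]])
    also have "0 + 2 * r / q * (1 * K x + K' x * x) = 2 * r / q * (1 + 2 * r\<^sup>2 * x\<^sup>2 * K x + r * x * q)"
      unfolding parts[symmetric] by (simp add: mult.commute)
    also have "\<dots> = 2 * r\<^sup>2 * x * G x + 2 * r / q"
      using q by (simp add: G_def field_simps power2_eq_square)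
    finally show ?thesis by (simp add: G_def[abs_def])
  qed
  \<comment> \<open>\<open>G\<close> and \<open>e\<close> solve the same linear equation with the same value at 0.\<close>
  define D where "D x = (G x - e x) * exp (- r\<^sup>2 * x\<^sup>2)" for x
  have "(D has_field_derivative 0) (at x)" for x
  proof -
    have "((\<lambda>x. (G x - e x) * exp (- r\<^sup>2 * x\<^sup>2)) has_field_derivative
       ((2 * r\<^sup>2 * x * G x + 2 * r / q) - e' x) * exp (- r\<^sup>2 * x\<^sup>2) +
       exp (- r\<^sup>2 * x\<^sup>2) * (- r\<^sup>2 * (2 * x)) * (G x - e x)) (at x)"
      by (intro DERIV_mult DERIV_diff G' e') (auto intro!: derivative_eq_intros)
    then show ?thesis by (simp add: D_def[abs_def] e'_def algebra_simps)
  qed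
  then obtain d where "\<And>x. D x = d"
    using has_field_derivative_zero_constant[of UNIV D] by auto
  moreover have "D 0 = 0" by (simp add: D_def G_def e_def)
  ultimately have "D x = 0" by metis
  then have "G x = e x" by (simp add: D_def)
  then have "e x - 1 = 2 * r * x * K x / q" by (simp add: G_def algebra_simps)
  then have "2 * r * x * K x = q * (e x - 1)" using q by simp
  then show ?thesis by (simp add: K_def s_def q_def e_def)
qed

section \<open>Solutions as sums over complex exponents\<close>

text \<open>By L'Hospital's rule. The functions of interest are smooth in \<open>\<surd>t\<close> only, so their behaviour at
  the end point has to be read off from the interior.\<close>

lemma right_derivative_from_limit:
  fixes f :: "real \<Rightarrow> real"
  assumes cont: "(f \<longlongrightarrow> f 0) (at_right 0)"
    and deriv: "\<And>t. t > 0 \<Longrightarrow> (f has_real_derivative f' t) (at t)"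
    and lim: "(f' \<longlongrightarrow> l) (at_right 0)"
  shows "(f has_real_derivative l) (at 0 within {0..})"
proof -
  have pos: "eventually (\<lambda>t::real. t > 0) (at_right 0)"
    by (simp add: eventually_at_right_less)
  have "((\<lambda>t. (f t - f 0) / t) \<longlongrightarrow> l) (at_right 0)"
  proof (rule lhopital_right_0[where f' = f' and g' = "\<lambda>_. 1"])
    show "((\<lambda>t. f t - f 0) \<longlongrightarrow> 0) (at_right 0)"
      using tendsto_diff[OF cont tendsto_const[of "f 0"]] by simp
    show "eventually (\<lambda>t. ((\<lambda>t. f t - f 0) has_real_derivative f' t) (at t)) (at_right 0)"
      using pos by eventually_elim (auto intro!: derivative_eq_intros deriv)
  qed (use lim pos in \<open>auto intro: tendsto_ident_at elim: eventually_mono\<close>)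
  moreover have "at 0 within {0..} = at_right (0::real)"
  proof -
    have "{0..} - {0} = {0<..} - {0::real}" by auto
    then show ?thesis by (simp only: at_within_def)
  qed
  ultimately show ?thesis by (simp add: has_field_derivative_iff)
qed

definition exp_erfc_sum :: "complex set \<Rightarrow> (complex \<Rightarrow> complex) \<Rightarrow> real \<Rightarrow> complex" where
  "exp_erfc_sum Z \<alpha> t = (\<Sum>z\<in>Z. \<alpha> z * exp_erfc z (of_real (sqrt t)))"

lemma continuous_on_exp_erfc_sum: "continuous_on S (exp_erfc_sum Z \<alpha>)"
  unfolding exp_erfc_sum_def by (intro continuous_intros)

text \<open>The derivative of a single term is \<open>z\<^sup>2 E\<^sub>z + z/\<surd>(\<pi>t)\<close>; the hypothesis makes the singular
  parts cancel, so that the derivative is a sum of the same kind and can be differentiated again.\<close>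

lemma exp_erfc_sum_has_vector_derivative:
  assumes t: "t > 0" and cancel: "(\<Sum>z\<in>Z. \<alpha> z * z) = 0"
  shows "(exp_erfc_sum Z \<alpha> has_vector_derivative exp_erfc_sum Z (\<lambda>z. \<alpha> z * z\<^sup>2) t) (at t)"
proof -
  let ?x = "complex_of_real (sqrt t)"
  have E: "((\<lambda>t. exp_erfc z (of_real (sqrt t))) has_vector_derivative
      z\<^sup>2 * exp_erfc z ?x + z * (1 / of_real (sqrt pi * sqrt t))) (at t)" for z
  proof -
    have "((\<lambda>t. complex_of_real (sqrt t)) has_vector_derivative of_real (inverse (sqrt t) / 2)) (at t)"
      using t by (intro has_vector_derivative_of_real)
        (auto simp: has_real_derivative_iff_has_vector_derivative[symmetric] intro!: derivative_eq_intros)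
    then have "((exp_erfc z \<circ> (\<lambda>t. of_real (sqrt t))) has_vector_derivative
        of_real (inverse (sqrt t) / 2) * (2 * z\<^sup>2 * ?x * exp_erfc z ?x + 2 * z / of_real (sqrt pi))) (at t)"
      by (rule field_vector_diff_chain_at) (rule exp_erfc_has_field_derivative)
    also have "of_real (inverse (sqrt t) / 2) * (2 * z\<^sup>2 * ?x * exp_erfc z ?x + 2 * z / of_real (sqrt pi)) =
        z\<^sup>2 * exp_erfc z ?x + z * (1 / of_real (sqrt pi * sqrt t))"
      using t by (simp add: field_simps)
    finally show ?thesis by (simp add: o_def)
  qed
  have "((\<lambda>t. \<Sum>z\<in>Z. \<alpha> z * exp_erfc z (of_real (sqrt t))) has_vector_derivative
      (\<Sum>z\<in>Z. \<alpha> z * (z\<^sup>2 * exp_erfc z ?x + z * (1 / of_real (sqrt pi * sqrt t))))) (at t)"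
    by (intro has_vector_derivative_sum has_vector_derivative_mult_right E)
  also have "(\<Sum>z\<in>Z. \<alpha> z * (z\<^sup>2 * exp_erfc z ?x + z * (1 / of_real (sqrt pi * sqrt t)))) =
      exp_erfc_sum Z (\<lambda>z. \<alpha> z * z\<^sup>2) t + (\<Sum>z\<in>Z. \<alpha> z * z) * (1 / of_real (sqrt pi * sqrt t))"
    by (simp add: exp_erfc_sum_def distrib_left sum.distrib sum_distrib_right sum_divide_distrib mult.assoc)
  finally show ?thesis unfolding cancel by (simp add: exp_erfc_sum_def[abs_def])
qed

text \<open>Half-order integration divides the coefficient of \<open>E\<^sub>z\<close> by \<open>z\<close> and leaves a constant, which
  vanishes by hypothesis. The functional \<open>L\<close> stands for the real or the imaginary part, because the
  Caputo derivative is formed for real functions.\<close>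

lemma exp_erfc_sum_Abel_integral:
  fixes L :: "complex \<Rightarrow> real"
  assumes L: "bounded_linear L" and t: "t > 0" and Z: "finite Z" "0 \<notin> Z" and cancel: "(\<Sum>z\<in>Z. \<alpha> z / z) = 0"
  shows "(\<lambda>\<tau>. L (exp_erfc_sum Z \<alpha> \<tau>) / sqrt (t - \<tau>)) absolutely_integrable_on {0..t}"
    and "integral {0..t} (\<lambda>\<tau>. L (exp_erfc_sum Z \<alpha> \<tau>) / sqrt (t - \<tau>)) =
      sqrt pi * L (exp_erfc_sum Z (\<lambda>z. \<alpha> z / z) t)"
proof -
  interpret L: bounded_linear L by (rule L)
  define g where "g x = (\<Sum>z\<in>Z. \<alpha> z * exp_erfc z (of_real x))" for x :: real
  have gc: "continuous_on A g" for A
    unfolding g_def by (intro continuous_intros)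
  have "continuous_on {0..sqrt t} (\<lambda>x. L (g x))"
    by (rule L.continuous_on[OF gc])
  note Abel = Abel_kernel_substitution[OF t this]
  have eq: "L (exp_erfc_sum Z \<alpha> \<tau>) = L (g (sqrt \<tau>))" for \<tau>
    by (simp add: exp_erfc_sum_def g_def)
  show "(\<lambda>\<tau>. L (exp_erfc_sum Z \<alpha> \<tau>) / sqrt (t - \<tau>)) absolutely_integrable_on {0..t}"
    using Abel(1) by (simp add: eq)
  let ?x = "complex_of_real (sqrt t)"
  let ?S = "\<lambda>z \<theta>. of_real (sin \<theta>) * exp_erfc z (?x * of_real (sin \<theta>))"
  have S_int: "?S z integrable_on {0..pi/2}" for z
    by (intro integrable_continuous_interval continuous_intros)
  have "integral {0..t} (\<lambda>\<tau>. L (exp_erfc_sum Z \<alpha> \<tau>) / sqrt (t - \<tau>)) =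
      integral {0..pi/2} (\<lambda>\<theta>. L (\<Sum>z\<in>Z. (2 * ?x * \<alpha> z) * ?S z \<theta>))"
    unfolding eq Abel(2)
  proof (rule integral_cong)
    fix \<theta> :: real
    have "2 * sqrt t * (sin \<theta> * L (g (sqrt t * sin \<theta>))) = L ((2 * sqrt t * sin \<theta>) *\<^sub>R g (sqrt t * sin \<theta>))"
      by (simp add: L.scaleR)
    also have "(2 * sqrt t * sin \<theta>) *\<^sub>R g (sqrt t * sin \<theta>) = (\<Sum>z\<in>Z. (2 * ?x * \<alpha> z) * ?S z \<theta>)"
      by (simp add: g_def scaleR_conv_of_real sum_distrib_left mult_ac)
    finally show "2 * sqrt t * (sin \<theta> * L (g (sqrt t * sin \<theta>))) = L (\<Sum>z\<in>Z. (2 * ?x * \<alpha> z) * ?S z \<theta>)" .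
  qed
  also have "\<dots> = L (integral {0..pi/2} (\<lambda>\<theta>. \<Sum>z\<in>Z. (2 * ?x * \<alpha> z) * ?S z \<theta>))"
    by (rule integral_linear[OF _ L, unfolded o_def])
      (intro integrable_continuous_interval continuous_intros)
  also have "integral {0..pi/2} (\<lambda>\<theta>. \<Sum>z\<in>Z. (2 * ?x * \<alpha> z) * ?S z \<theta>) =
      (\<Sum>z\<in>Z. (2 * ?x * \<alpha> z) * integral {0..pi/2} (?S z))"
    by (subst integral_sum) (auto intro!: integrable_on_mult_right S_int Z(1))
  also have "\<dots> = (\<Sum>z\<in>Z. of_real (sqrt pi) * (\<alpha> z / z * exp_erfc z ?x - \<alpha> z / z))"
  proof (rule sum.cong[OF refl])
    fix z assume "z \<in> Z"
    then have z: "z \<noteq> 0" using Z by auto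
    have "(2 * ?x * \<alpha> z) * integral {0..pi/2} (?S z) = \<alpha> z / z * (2 * z * ?x * integral {0..pi/2} (?S z))"
      using z by simp
    also have "\<dots> = \<alpha> z / z * (of_real (sqrt pi) * (exp_erfc z ?x - 1))"
      by (simp only: integral_sin_exp_erfc[OF z])
    finally show "(2 * ?x * \<alpha> z) * integral {0..pi/2} (?S z) = of_real (sqrt pi) * (\<alpha> z / z * exp_erfc z ?x - \<alpha> z / z)"
      by (simp add: algebra_simps)
  qed
  also have "\<dots> = sqrt pi *\<^sub>R exp_erfc_sum Z (\<lambda>z. \<alpha> z / z) t"
    by (simp add: exp_erfc_sum_def sum_subtractf cancel scaleR_conv_of_real flip: sum_distrib_left)
  finally show "integral {0..t} (\<lambda>\<tau>. L (exp_erfc_sum Z \<alpha> \<tau>) / sqrt (t - \<tau>)) =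
      sqrt pi * L (exp_erfc_sum Z (\<lambda>z. \<alpha> z / z) t)"
    by (simp add: L.scaleR)
qed

text \<open>Differentiation multiplies the coefficients by \<open>z\<^sup>2\<close> and half-order integration divides them by
  \<open>z\<close>, so the terms of the equation contribute \<open>a z\<^sup>4\<close>, \<open>b z\<^sup>3\<close> and \<open>c\<close>. The two vanishing moments
  are those that two differentiations and one half-order integration need.\<close>

lemma exp_erfc_sum_solution:
  fixes L :: "complex \<Rightarrow> real"
  assumes L: "bounded_linear L" and Z: "finite Z" "0 \<notin> Z"
    and moments: "(\<Sum>z\<in>Z. \<alpha> z) = of_real y0" "(\<Sum>z\<in>Z. \<alpha> z * z) = 0"
      "(\<Sum>z\<in>Z. \<alpha> z * z\<^sup>2) = of_real v0" "(\<Sum>z\<in>Z. \<alpha> z * z ^ 3) = 0"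
    and forcing: "\<And>t. t > 0 \<Longrightarrow>
      exp_erfc_sum Z (\<lambda>z. \<alpha> z * poly (bt_poly a b c) z) t = of_real (\<Omega> * sin (\<omega> * t))"
  shows "bagley_torvik_solution a b c (\<Omega> * L 1) \<omega> (y0 * L 1) (v0 * L 1) (\<lambda>t. L (exp_erfc_sum Z \<alpha> t))"
proof -
  interpret L: bounded_linear L by (rule L)
  have L_of_real: "L (of_real x) = x * L 1" for x
    using L.scaleR[of x 1] by (simp add: scaleR_conv_of_real)
  let ?y = "\<lambda>t. L (exp_erfc_sum Z \<alpha> t)"
  let ?Y1 = "exp_erfc_sum Z (\<lambda>z. \<alpha> z * z\<^sup>2)" and ?Y2 = "exp_erfc_sum Z (\<lambda>z. \<alpha> z * z^4)"
  have y': "(?y has_real_derivative L (?Y1 t)) (at t)" if "t > 0" for t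
    unfolding has_real_derivative_iff_has_vector_derivative
    by (rule L.has_vector_derivative[OF exp_erfc_sum_has_vector_derivative[OF that moments(2)]])
  have Y1': "((\<lambda>t. L (?Y1 t)) has_real_derivative L (?Y2 t)) (at t)" if "t > 0" for t
  proof -
    have "(\<Sum>z\<in>Z. \<alpha> z * z\<^sup>2 * z) = 0"
      using moments(4) by (simp add: mult.assoc power2_eq_square power3_eq_cube)
    from exp_erfc_sum_has_vector_derivative[OF that this]
    have "(?Y1 has_vector_derivative ?Y2 t) (at t)"
      by (simp add: mult.assoc flip: power_add)
    then show ?thesis
      unfolding has_real_derivative_iff_has_vector_derivative by (rule L.has_vector_derivative)
  qed
  have dy: "deriv ?y t = L (?Y1 t)" if "t > 0" for t
    by (rule DERIV_imp_deriv[OF y'[OF that]])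
  have y'': "(deriv ?y has_real_derivative L (?Y2 t)) (at t)" if "t > 0" for t
  proof (rule DERIV_cong_ev[THEN iffD2, OF refl _ refl])
    show "eventually (\<lambda>s. deriv ?y s = L (?Y1 s)) (nhds t)"
      using eventually_nhds_in_open[of "{0<..}" t] that by (auto elim!: eventually_mono simp: dy)
    show "((\<lambda>t. L (?Y1 t)) has_real_derivative L (?Y2 t)) (at t)" by (rule Y1'[OF that])
  qed
  have ddy: "deriv (deriv ?y) t = L (?Y2 t)" if "t > 0" for t
    by (rule DERIV_imp_deriv[OF y''[OF that]])
  have div: "\<alpha> z * z^4 / z = \<alpha> z * z^3" for z
    by (simp add: power4_eq_xxxx power3_eq_cube)
  have "(\<Sum>z\<in>Z. \<alpha> z * z^4 / z) = 0" using moments(4) by (simp only: div)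
  note Abel = exp_erfc_sum_Abel_integral[OF L _ Z this, unfolded div]
  have ai: "(\<lambda>\<tau>. deriv (deriv ?y) \<tau> / sqrt (t - \<tau>)) absolutely_integrable_on {0..t}" if "t > 0" for t
    by (rule absolutely_integrable_spike[OF Abel(1)[OF that], of "{0}"]) (auto simp: ddy)
  have caputo: "caputo_3_2 ?y t = L (exp_erfc_sum Z (\<lambda>z. \<alpha> z * z^3) t)" if "t > 0" for t
  proof -
    have "integral {0..t} (\<lambda>\<tau>. deriv (deriv ?y) \<tau> / sqrt (t - \<tau>)) =
        integral {0..t} (\<lambda>\<tau>. L (?Y2 \<tau>) / sqrt (t - \<tau>))"
      by (rule integral_spike[of "{0}"]) (auto simp: ddy)
    then show ?thesis
      by (simp add: caputo_3_2_def Abel(2)[OF that] Gamma_one_half_real)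
  qed
  have lim0: "((\<lambda>t. L (exp_erfc_sum Z \<beta> t)) \<longlongrightarrow> L (exp_erfc_sum Z \<beta> 0)) (at_right 0)" for \<beta>
  proof (rule L.tendsto)
    have "isCont (exp_erfc_sum Z \<beta>) 0"
      using continuous_on_exp_erfc_sum[of UNIV Z \<beta>] by (simp add: continuous_on_eq_continuous_at)
    then show "(exp_erfc_sum Z \<beta> \<longlongrightarrow> exp_erfc_sum Z \<beta> 0) (at_right 0)"
      by (simp add: isCont_def filterlim_at_split)
  qed
  show ?thesis
    unfolding bagley_torvik_solution_def
  proof (intro conjI allI impI)
    show "?y 0 = y0 * L 1"
      by (simp add: exp_erfc_sum_def moments L_of_real)
    have "L (?Y1 0) = v0 * L 1"
      by (simp add: exp_erfc_sum_def moments L_of_real)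
    moreover have "(?y \<longlongrightarrow> ?y 0) (at_right 0)" "((\<lambda>t. L (?Y1 t)) \<longlongrightarrow> L (?Y1 0)) (at_right 0)"
      by (rule lim0)+
    ultimately show "(?y has_real_derivative v0 * L 1) (at 0 within {0..})"
      using right_derivative_from_limit[of ?y "\<lambda>t. L (?Y1 t)"] y' by simp
    fix t :: real assume t: "t > 0"
    show "?y differentiable at t" "deriv ?y differentiable at t"
      using y'[OF t] y''[OF t] by (auto simp: real_differentiable_def)
    show "(\<lambda>\<tau>. deriv (deriv ?y) \<tau> / sqrt (t - \<tau>)) absolutely_integrable_on {0..t}" by (rule ai[OF t])
    have "a * deriv (deriv ?y) t + b * caputo_3_2 ?y t + c * ?y t =
        L (a *\<^sub>R ?Y2 t + b *\<^sub>R exp_erfc_sum Z (\<lambda>z. \<alpha> z * z^3) t + c *\<^sub>R exp_erfc_sum Z \<alpha> t)"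
      by (simp add: ddy[OF t] caputo[OF t] L.add L.scaleR)
    also have "a *\<^sub>R ?Y2 t + b *\<^sub>R exp_erfc_sum Z (\<lambda>z. \<alpha> z * z^3) t + c *\<^sub>R exp_erfc_sum Z \<alpha> t =
        exp_erfc_sum Z (\<lambda>z. \<alpha> z * poly (bt_poly a b c) z) t"
      unfolding exp_erfc_sum_def scaleR_sum_right sum.distrib[symmetric]
      by (rule sum.cong) (simp_all add: bt_poly_def scaleR_conv_of_real algebra_simps power3_eq_cube power4_eq_xxxx)
    finally show "a * deriv (deriv ?y) t + b * caputo_3_2 ?y t + c * ?y t = \<Omega> * L 1 * sin (\<omega> * t)"
      by (simp add: forcing[OF t] L_of_real del: of_real_mult)
  qed
qed

section \<open>Uniqueness\<close>

text \<open>The derivative \<open>v\<close> oscillates by at most \<open>\<integral>\<bar>f\<bar>\<close>. At 0 only the one-sided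
  derivative of \<open>w\<close> is known, but \<open>w(x)/x\<close> is small for small \<open>x\<close>, and by the mean value theorem it is
  a value of \<open>v\<close>. Hence \<open>\<bar>v\<bar> \<le> \<integral>\<bar>f\<bar>\<close>.\<close>

lemma abs_le_mult_integral_second_derivative:
  fixes w :: "real \<Rightarrow> real"
  assumes w0: "w 0 = 0" "(w has_real_derivative 0) (at 0 within {0..})"
    and w': "\<And>t. t > 0 \<Longrightarrow> (w has_real_derivative v t) (at t)"
    and v': "\<And>t. t > 0 \<Longrightarrow> (v has_real_derivative f t) (at t)"
    and f: "f absolutely_integrable_on {0..t}" and t: "t > 0"
  shows "\<bar>w t\<bar> \<le> t * integral {0..t} (\<lambda>\<tau>. \<bar>f \<tau>\<bar>)"
proof -
  let ?M = "integral {0..t} (\<lambda>\<tau>. \<bar>f \<tau>\<bar>)"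
  have absf: "(\<lambda>\<tau>. \<bar>f \<tau>\<bar>) integrable_on {0..t}"
    using f absolutely_integrable_on_def by (metis (no_types, lifting) real_norm_def integrable_cong)
  have incr: "\<bar>v s - v \<epsilon>\<bar> \<le> ?M" if "0 < \<epsilon>" "\<epsilon> \<le> s" "s \<le> t" for \<epsilon> s
  proof -
    have "(f has_integral v s - v \<epsilon>) {\<epsilon>..s}"
      using that by (intro fundamental_theorem_of_calculus)
        (auto intro!: has_field_derivative_at_within v' simp flip: has_real_derivative_iff_has_vector_derivative)
    then have "v s - v \<epsilon> = integral {\<epsilon>..s} f" and fi: "f integrable_on {\<epsilon>..s}"
      by (auto simp: integral_unique has_integral_integrable)
    moreover have "norm (integral {\<epsilon>..s} f) \<le> integral {\<epsilon>..s} (\<lambda>\<tau>. \<bar>f \<tau>\<bar>)"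
      by (rule integral_norm_bound_integral[OF fi integrable_subinterval_real[OF absf]]) (use that in auto)
    moreover have "integral {\<epsilon>..s} (\<lambda>\<tau>. \<bar>f \<tau>\<bar>) \<le> ?M"
      using that by (intro integral_subset_le absf integrable_subinterval_real[OF absf]) auto
    ultimately show ?thesis by simp
  qed
  have cont: "continuous_on {0..x} w" for x
    unfolding continuous_on_eq_continuous_within
  proof
    fix y assume "y \<in> {0..x}"
    then consider "y = 0" | "y > 0" by fastforce
    then show "continuous (at y within {0..x}) w"
    proof cases
      case 1
      have "continuous (at 0 within {0..}) w"
        using w0(2) by (rule DERIV_continuous)
      then show ?thesis using 1 continuous_within_subset[of 0 "{0..}" w "{0..x}"] by auto
    next
      case 2
      then show ?thesis using DERIV_isCont[OF w'] continuous_at_imp_continuous_at_within by blast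
    qed
  qed
  have mvt: "\<exists>\<xi>. 0 < \<xi> \<and> \<xi> < x \<and> w x = x * v \<xi>" if "x > 0" for x
  proof -
    have "\<exists>l \<xi>. 0 < \<xi> \<and> \<xi> < x \<and> DERIV w \<xi> :> l \<and> w x - w 0 = (x - 0) * l"
      using that by (intro MVT cont) (auto intro: w' simp: real_differentiable_def)
    then show ?thesis using w' w0(1) DERIV_unique by fastforce
  qed
  have bound: "\<bar>v s\<bar> \<le> ?M" if s: "0 < s" "s \<le> t" for s
  proof (rule field_le_epsilon)
    fix e :: real assume "e > 0"
    have "((\<lambda>x. w x / x) \<longlongrightarrow> 0) (at 0 within {0..})"
      using w0 by (simp add: has_field_derivative_iff)
    then have "eventually (\<lambda>x. \<bar>w x / x\<bar> < e) (at 0 within {0..})"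
      using \<open>e > 0\<close> by (auto dest!: tendstoD[where e = e])
    then obtain d where d: "d > 0" "\<And>x. x \<ge> 0 \<Longrightarrow> x \<noteq> 0 \<Longrightarrow> dist x 0 < d \<Longrightarrow> \<bar>w x / x\<bar> < e"
      unfolding eventually_at by auto
    define x where "x = min (d / 2) s"
    have x: "0 < x" "x < d" "x \<le> s" using d(1) s by (auto simp: x_def)
    obtain \<xi> where \<xi>: "0 < \<xi>" "\<xi> < x" "w x = x * v \<xi>" using mvt[OF x(1)] by blast
    have "\<bar>v \<xi>\<bar> < e" using d(2)[of x] x \<xi>(3) by (simp add: dist_real_def)
    moreover have "\<bar>v s - v \<xi>\<bar> \<le> ?M" using \<xi> x s by (intro incr) auto
    ultimately show "\<bar>v s\<bar> \<le> ?M + e" by linarith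
  qed
  obtain \<xi> where "0 < \<xi>" "\<xi> < t" "w t = t * v \<xi>" using mvt[OF t] by blast
  then show ?thesis using bound[of \<xi>] t by (simp add: abs_mult)
qed

text \<open>A derivative is a pointwise limit of continuous difference quotients.\<close>

lemma borel_measurable_derivative_on_halfline:
  fixes v f :: "real \<Rightarrow> real"
  assumes v': "\<And>t. t > 0 \<Longrightarrow> (v has_real_derivative f t) (at t)"
  shows "(\<lambda>t. indicator {0<..} t * f t) \<in> borel_measurable borel"
proof -
  have "continuous_on {0<..} v"
    by (meson DERIV_isCont continuous_at_imp_continuous_on greaterThan_iff v')
  then have [measurable]: "(\<lambda>t. indicator {0<..} t *\<^sub>R v t) \<in> borel_measurable borel"
    by (intro borel_measurable_continuous_on_indicator) auto
  define g where "g t = indicator {0<..} t *\<^sub>R v t" for t :: real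
  have [measurable]: "g \<in> borel_measurable borel" unfolding g_def[abs_def] by measurable
  have lim: "(\<lambda>n. indicator {0<..} t * ((g (t + 1 / Suc n) - g t) * real (Suc n))) \<longlonglongrightarrow> indicator {0<..} t * f t" for t
  proof (cases "t > 0")
    case True
    have "((\<lambda>h. (v (t + h) - v t) / h) \<longlongrightarrow> f t) (at 0)"
      using v'[OF True] by (simp add: DERIV_def)
    moreover have "filterlim (\<lambda>n. 1 / real (Suc n)) (at 0) sequentially"
      by (intro filterlim_atI) (auto intro: LIMSEQ_inverse_real_of_nat simp: inverse_eq_divide[symmetric] simp del: of_nat_Suc)
    ultimately have "(\<lambda>n. (v (t + 1 / Suc n) - v t) / (1 / real (Suc n))) \<longlonglongrightarrow> f t"
      by (rule filterlim_compose)
    moreover have "t + 1 / real (Suc n) > 0" for n using True by (simp add: add_pos_nonneg)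
    ultimately show ?thesis using True by (simp add: g_def del: of_nat_Suc)
  qed simp
  show ?thesis
    by (rule borel_measurable_LIMSEQ_real[OF lim]) measurable
qed

text \<open>Since \<open>exp (- \<mu> s) \<le> 1/(1 + \<mu> s)\<close>, the integrand is dominated by the derivative of
  \<open>(2/\<surd>\<mu>) arctan \<surd>(\<mu> s)\<close>. What matters is that the bound tends to 0 for large \<open>\<mu>\<close>.\<close>

lemma Abel_Laplace_bound:
  fixes \<mu> T :: real
  assumes "\<mu> > 0" "T > 0"
  shows "(\<integral>\<^sup>+s. ennreal (1 / sqrt s * exp (- \<mu> * s)) * indicator {0..T} s \<partial>lborel) \<le> ennreal (pi / sqrt \<mu>)"
proof -
  have "((\<lambda>s. 1 / (sqrt s * (1 + \<mu> * s))) has_integral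
      2 / sqrt \<mu> * arctan (sqrt (\<mu> * T)) - 2 / sqrt \<mu> * arctan (sqrt (\<mu> * 0))) {0..T}"
  proof (rule fundamental_theorem_of_calculus_interior)
    fix s assume "s \<in> {0<..<T}"
    then have s: "s > 0" by simp
    have "\<mu> * s > 0" using s assms by simp
    then have "((\<lambda>s. arctan (sqrt (\<mu> * s))) has_real_derivative
        inverse (1 + (sqrt (\<mu> * s))\<^sup>2) * (inverse (sqrt (\<mu> * s)) / 2 * \<mu>)) (at s)"
      by (auto intro!: derivative_eq_intros)
    then have "((\<lambda>s. 2 / sqrt \<mu> * arctan (sqrt (\<mu> * s))) has_real_derivative
        2 / sqrt \<mu> * (inverse (1 + (sqrt (\<mu> * s))\<^sup>2) * (inverse (sqrt (\<mu> * s)) / 2 * \<mu>))) (at s)"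
      by (rule DERIV_cmult)
    also have "2 / sqrt \<mu> * (inverse (1 + (sqrt (\<mu> * s))\<^sup>2) * (inverse (sqrt (\<mu> * s)) / 2 * \<mu>)) =
        1 / (sqrt s * (1 + \<mu> * s))"
    proof -
      have "2 / m * (inverse x * (inverse (m * n) / 2 * u)) = u / (m * m) * (1 / (n * x))"
        for m n x u :: real
        by (cases "m = 0 \<or> n = 0 \<or> x = 0") (auto simp: field_simps)
      moreover have "(sqrt (\<mu> * s))\<^sup>2 = \<mu> * s" using \<open>\<mu> * s > 0\<close> by simp
      moreover have "sqrt (\<mu> * s) = sqrt \<mu> * sqrt s" by (rule real_sqrt_mult)
      moreover have "\<mu> / (sqrt \<mu> * sqrt \<mu>) = 1" using assms by simp
      ultimately show ?thesis by (metis mult_1)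
    qed
    finally show "((\<lambda>s. 2 / sqrt \<mu> * arctan (sqrt (\<mu> * s))) has_vector_derivative
        1 / (sqrt s * (1 + \<mu> * s))) (at s)"
      by (simp add: has_real_derivative_iff_has_vector_derivative)
  qed (use assms in \<open>auto intro!: continuous_intros\<close>)
  then have "(\<integral>\<^sup>+s. ennreal (1 / (sqrt s * (1 + \<mu> * s))) * indicator {0..T} s \<partial>lborel) =
      ennreal (2 / sqrt \<mu> * arctan (sqrt (\<mu> * T)))"
    using assms by (intro nn_integral_has_integral_lebesgue') auto
  moreover have "(\<integral>\<^sup>+s. ennreal (1 / sqrt s * exp (- \<mu> * s)) * indicator {0..T} s \<partial>lborel) \<le>
      (\<integral>\<^sup>+s. ennreal (1 / (sqrt s * (1 + \<mu> * s))) * indicator {0..T} s \<partial>lborel)"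
  proof (rule nn_integral_mono)
    fix s :: real
    show "ennreal (1 / sqrt s * exp (- \<mu> * s)) * indicator {0..T} s \<le>
        ennreal (1 / (sqrt s * (1 + \<mu> * s))) * indicator {0..T} s"
    proof (cases "s \<in> {0..T}")
      case True
      then have pos: "1 + \<mu> * s > 0" using assms by (simp add: add_pos_nonneg)
      have "exp (- \<mu> * s) = 1 / exp (\<mu> * s)" by (simp add: exp_minus inverse_eq_divide)
      also have "\<dots> \<le> 1 / (1 + \<mu> * s)"
        using pos exp_ge_add_one_self[of "\<mu> * s"] by (intro divide_left_mono) auto
      finally have "1 / sqrt s * exp (- \<mu> * s) \<le> 1 / sqrt s * (1 / (1 + \<mu> * s))"
        using True by (intro mult_left_mono) auto
      then show ?thesis using True by (simp add: ennreal_leI)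
    qed simp
  qed
  moreover have "2 / sqrt \<mu> * arctan (sqrt (\<mu> * T)) \<le> pi / sqrt \<mu>"
    using arctan_ubound[of "sqrt (\<mu> * T)"] assms by (simp add: field_simps)
  ultimately show ?thesis by (metis (no_types, lifting) ennreal_leI order_trans)
qed

text \<open>Multiply the inequality by \<open>exp (- \<mu> t)\<close> and distribute this weight over \<open>\<tau>\<close> and \<open>t - \<tau>\<close>.
  By Tonelli's theorem the weighted integral \<open>M\<close> of \<open>\<bar>f\<bar>\<close> satisfies \<open>M \<le> (C \<pi>/\<surd>\<mu>) M\<close>, and \<open>M\<close> is
  finite, so \<open>M = 0\<close> as soon as \<open>\<surd>\<mu> > C \<pi>\<close>.\<close>

lemma Volterra_Abel_inequality_imp_zero:
  fixes f :: "real \<Rightarrow> real"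
  assumes T: "T > 0" and C: "C \<ge> 0"
    and meas: "(\<lambda>t. indicator {0<..} t * f t) \<in> borel_measurable borel"
    and f: "f absolutely_integrable_on {0..T}"
    and abel: "\<And>t. 0 < t \<Longrightarrow> t < T \<Longrightarrow> (\<lambda>\<tau>. f \<tau> / sqrt (t - \<tau>)) absolutely_integrable_on {0..t}"
    and ineq: "\<And>t. 0 < t \<Longrightarrow> t < T \<Longrightarrow>
      \<bar>f t\<bar> \<le> C * integral {0..t} (\<lambda>\<tau>. \<bar>f \<tau> / sqrt (t - \<tau>)\<bar>)"
  shows "integral {0..T} (\<lambda>\<tau>. \<bar>f \<tau>\<bar>) = 0"
proof -
  have absI: "((\<lambda>x. \<bar>g x\<bar>) has_integral integral {0..t} (\<lambda>x. \<bar>g x\<bar>)) {0<..<t}"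
    if "g absolutely_integrable_on {0..t}" for g :: "real \<Rightarrow> real" and t
  proof -
    have "(\<lambda>x. norm (g x)) integrable_on {0..t}"
      using that by (simp add: absolutely_integrable_on_def)
    then show ?thesis by (simp add: has_integral_Icc_iff_Ioo[symmetric] integrable_integral)
  qed
  \<comment> \<open>This choice makes the contraction factor \<open>C \<pi>/\<surd>\<mu>\<close> at most \<open>1/2\<close>.\<close>
  define \<mu> where "\<mu> = (2 * C * pi + 1)\<^sup>2"
  have s\<mu>: "sqrt \<mu> = 2 * C * pi + 1" using C by (simp add: \<mu>_def)
  have "0 \<le> 2 * C * pi" using C by simp
  then have \<mu>: "\<mu> > 0" and half: "C * (pi / sqrt \<mu>) \<le> 1 / 2"
    by (simp_all add: \<mu>_def s\<mu> zero_less_power2 add_nonneg_eq_0_iff field_simps)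
  define \<phi> where "\<phi> t = ennreal \<bar>f t\<bar> * indicator {0<..<T} t" for t
  define \<psi> where "\<psi> t = \<phi> t * ennreal (exp (- \<mu> * t))" for t
  define \<kappa> where "\<kappa> s = ennreal (1 / sqrt s * exp (- \<mu> * s)) * indicator {0..T} s" for s
  have "\<phi> = (\<lambda>t. ennreal \<bar>indicator {0<..} t * f t\<bar> * indicator {0<..<T} t)"
    by (auto simp: \<phi>_def fun_eq_iff split: split_indicator)
  then have [measurable]: "\<phi> \<in> borel_measurable borel" using meas by simp
  have [measurable]: "\<psi> \<in> borel_measurable borel" "\<kappa> \<in> borel_measurable borel"
    unfolding \<psi>_def[abs_def] \<kappa>_def[abs_def] by measurable
  define M where "M = (\<integral>\<^sup>+t. \<psi> t \<partial>lborel)"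
  have \<phi>: "(\<integral>\<^sup>+t. \<phi> t \<partial>lborel) = ennreal (integral {0..T} (\<lambda>\<tau>. \<bar>f \<tau>\<bar>))"
    unfolding \<phi>_def by (rule nn_integral_has_integral_lebesgue'[OF _ absI[OF f]]) auto
  have step: "\<psi> t \<le> ennreal C * (\<integral>\<^sup>+\<tau>. \<psi> \<tau> * \<kappa> (t - \<tau>) \<partial>lborel)" for t
  proof (cases "t \<in> {0<..<T}")
    case True
    then have t: "0 < t" "t < T" by auto
    let ?J = "integral {0..t} (\<lambda>\<tau>. \<bar>f \<tau> / sqrt (t - \<tau>)\<bar>)"
    have "((\<lambda>\<tau>. exp (- \<mu> * t) * \<bar>f \<tau> / sqrt (t - \<tau>)\<bar>) has_integral exp (- \<mu> * t) * ?J) {0<..<t}"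
      by (rule has_integral_mult_right[OF absI[OF abel[OF t]]])
    then have "ennreal (exp (- \<mu> * t) * ?J) =
        (\<integral>\<^sup>+\<tau>. ennreal (exp (- \<mu> * t) * \<bar>f \<tau> / sqrt (t - \<tau>)\<bar>) * indicator {0<..<t} \<tau> \<partial>lborel)"
      by (intro nn_integral_has_integral_lebesgue'[symmetric]) auto
    also have "\<dots> \<le> (\<integral>\<^sup>+\<tau>. \<psi> \<tau> * \<kappa> (t - \<tau>) \<partial>lborel)"
    proof (rule nn_integral_mono)
      fix \<tau> :: real
      show "ennreal (exp (- \<mu> * t) * \<bar>f \<tau> / sqrt (t - \<tau>)\<bar>) * indicator {0<..<t} \<tau> \<le> \<psi> \<tau> * \<kappa> (t - \<tau>)"
      proof (cases "\<tau> \<in> {0<..<t}")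
        case True
        have "exp (- \<mu> * t) = exp (- \<mu> * \<tau>) * exp (- \<mu> * (t - \<tau>))"
          by (simp add: algebra_simps flip: exp_add)
        then have "exp (- \<mu> * t) * \<bar>f \<tau> / sqrt (t - \<tau>)\<bar> =
            (\<bar>f \<tau>\<bar> * exp (- \<mu> * \<tau>)) * (1 / sqrt (t - \<tau>) * exp (- \<mu> * (t - \<tau>)))"
          using True by (simp add: abs_divide)
        then have "ennreal (exp (- \<mu> * t) * \<bar>f \<tau> / sqrt (t - \<tau>)\<bar>) =
            ennreal \<bar>f \<tau>\<bar> * ennreal (exp (- \<mu> * \<tau>)) * ennreal (1 / sqrt (t - \<tau>) * exp (- \<mu> * (t - \<tau>)))"
          using True by (simp only:) (subst ennreal_mult; simp add: ennreal_mult)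
        then show ?thesis using True t by (simp add: \<psi>_def \<phi>_def \<kappa>_def)
      qed simp
    qed
    finally have J: "ennreal (exp (- \<mu> * t) * ?J) \<le> (\<integral>\<^sup>+\<tau>. \<psi> \<tau> * \<kappa> (t - \<tau>) \<partial>lborel)" .
    have "\<psi> t = ennreal (\<bar>f t\<bar> * exp (- \<mu> * t))"
      using True by (simp add: \<psi>_def \<phi>_def ennreal_mult)
    also have "\<dots> \<le> ennreal (C * (exp (- \<mu> * t) * ?J))"
      using mult_right_mono[OF ineq[OF t], of "exp (- \<mu> * t)"] by (intro ennreal_leI) (simp add: mult_ac)
    also have "\<dots> = ennreal C * ennreal (exp (- \<mu> * t) * ?J)"
      using C by (simp add: ennreal_mult')
    also have "\<dots> \<le> ennreal C * (\<integral>\<^sup>+\<tau>. \<psi> \<tau> * \<kappa> (t - \<tau>) \<partial>lborel)"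
      by (intro mult_left_mono J) simp
    finally show ?thesis .
  qed (simp add: \<psi>_def \<phi>_def)
  have shift: "(\<integral>\<^sup>+t. \<kappa> (t - \<tau>) \<partial>lborel) = (\<integral>\<^sup>+s. \<kappa> s \<partial>lborel)" for \<tau>
    using nn_integral_real_affine[of \<kappa> 1 "- \<tau>"] by simp
  have "M \<le> (\<integral>\<^sup>+t. ennreal C * (\<integral>\<^sup>+\<tau>. \<psi> \<tau> * \<kappa> (t - \<tau>) \<partial>lborel) \<partial>lborel)"
    unfolding M_def by (rule nn_integral_mono) (rule step)
  also have "\<dots> = ennreal C * (\<integral>\<^sup>+t. (\<integral>\<^sup>+\<tau>. \<psi> \<tau> * \<kappa> (t - \<tau>) \<partial>lborel) \<partial>lborel)"
    by (rule nn_integral_cmult) measurable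
  also have "(\<integral>\<^sup>+t. (\<integral>\<^sup>+\<tau>. \<psi> \<tau> * \<kappa> (t - \<tau>) \<partial>lborel) \<partial>lborel) =
      (\<integral>\<^sup>+\<tau>. (\<integral>\<^sup>+t. \<psi> \<tau> * \<kappa> (t - \<tau>) \<partial>lborel) \<partial>lborel)"
    by (rule lborel_pair.Fubini') measurable
  also have "\<dots> = (\<integral>\<^sup>+\<tau>. \<psi> \<tau> * (\<integral>\<^sup>+s. \<kappa> s \<partial>lborel) \<partial>lborel)"
    by (rule nn_integral_cong) (simp add: nn_integral_cmult shift)
  also have "\<dots> = M * (\<integral>\<^sup>+s. \<kappa> s \<partial>lborel)"
    unfolding M_def by (rule nn_integral_multc) measurable
  also have "ennreal C * (M * (\<integral>\<^sup>+s. \<kappa> s \<partial>lborel)) \<le> ennreal C * (M * ennreal (pi / sqrt \<mu>))"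
    unfolding \<kappa>_def by (intro mult_left_mono Abel_Laplace_bound \<mu> T) auto
  also have "\<dots> = ennreal (C * (pi / sqrt \<mu>)) * M"
  proof -
    have "ennreal (C * (pi / sqrt \<mu>)) = ennreal C * ennreal (pi / sqrt \<mu>)"
      using C \<mu> by (intro ennreal_mult) auto
    then show ?thesis by (simp only: mult_ac)
  qed
  also have "\<dots> \<le> ennreal (1 / 2) * M"
    by (intro mult_right_mono ennreal_leI half) simp
  finally have "M \<le> ennreal (1 / 2) * M" .
  moreover have "M < \<infinity>"
  proof -
    have "M \<le> (\<integral>\<^sup>+t. \<phi> t \<partial>lborel)"
      unfolding M_def
    proof (rule nn_integral_mono)
      fix t :: real
      show "\<psi> t \<le> \<phi> t"
      proof (cases "t > 0")
        case True
        then have "ennreal (exp (- \<mu> * t)) \<le> 1" using \<mu> by simp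
        then have "\<phi> t * ennreal (exp (- \<mu> * t)) \<le> \<phi> t * 1" by (intro mult_left_mono) auto
        then show ?thesis by (simp add: \<psi>_def)
      qed (simp add: \<psi>_def \<phi>_def)
    qed
    then show ?thesis unfolding \<phi> by (simp add: le_less_trans)
  qed
  ultimately have "M = 0"
  proof (cases M)
    case (real m)
    assume "M \<le> ennreal (1 / 2) * M"
    then have "ennreal m \<le> ennreal (1 / 2) * ennreal m" using real by simp
    also have "\<dots> = ennreal (1 / 2 * m)" using real by (intro ennreal_mult[symmetric]) auto
    finally have "m \<le> 1 / 2 * m" using real by (subst (asm) ennreal_le_iff) auto
    then show ?thesis using real by simp
  qed simp
  then have "AE t in lborel. \<psi> t = 0"
    unfolding M_def by (subst (asm) nn_integral_0_iff_AE) auto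
  then have "AE t in lborel. \<phi> t = 0"
    by eventually_elim (simp add: \<psi>_def)
  then have "(\<integral>\<^sup>+t. \<phi> t \<partial>lborel) = 0"
    by (subst nn_integral_0_iff_AE) auto
  then have "integral {0..T} (\<lambda>\<tau>. \<bar>f \<tau>\<bar>) \<le> 0" unfolding \<phi> by (rule ennreal_eq_0_iff[THEN iffD1])
  moreover have "integral {0..T} (\<lambda>\<tau>. \<bar>f \<tau>\<bar>) \<ge> 0"
    by (rule Henstock_Kurzweil_Integration.integral_nonneg)
      (use f in \<open>auto simp: absolutely_integrable_on_def\<close>)
  ultimately show ?thesis by simp
qed


lemma bagley_torvik_solutionD:
  assumes "bagley_torvik_solution a b c \<Omega> \<omega> y0 v0 y"
  shows "y 0 = y0" and "(y has_real_derivative v0) (at 0 within {0..})"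
    and "\<And>t. t > 0 \<Longrightarrow> (y has_real_derivative deriv y t) (at t)"
    and "\<And>t. t > 0 \<Longrightarrow> (deriv y has_real_derivative deriv (deriv y) t) (at t)"
    and "\<And>t. t > 0 \<Longrightarrow> (\<lambda>\<tau>. deriv (deriv y) \<tau> / sqrt (t - \<tau>)) absolutely_integrable_on {0..t}"
    and "\<And>t. t > 0 \<Longrightarrow>
      a * deriv (deriv y) t + b * caputo_3_2 y t + c * y t = \<Omega> * sin (\<omega> * t)"
  using assms by (auto simp: bagley_torvik_solution_def DERIV_deriv_iff_real_differentiable)

text \<open>Solving the equation for \<open>w''\<close> bounds \<open>\<bar>w''\<bar>\<close> by its own Abel integral: the Caputo term is such an
  integral up to a factor, and \<open>\<bar>w\<bar>\<close> is bounded by \<open>\<integral>\<bar>w''\<bar>\<close>, in which the factor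
  \<open>\<surd>s/\<surd>(s - \<tau>) \<ge> 1\<close> can be inserted.\<close>

lemma homogeneous_solution_eq_zero:
  assumes a: "a \<noteq> 0" and sol: "bagley_torvik_solution a b c 0 \<omega> 0 0 w" and "t \<ge> 0"
  shows "w t = 0"
proof (cases "t = 0")
  case True
  then show ?thesis using bagley_torvik_solutionD(1)[OF sol] by simp
next
  case False
  then have t: "t > 0" using \<open>t \<ge> 0\<close> by simp
  define f where "f = deriv (deriv w)"
  note w0 = bagley_torvik_solutionD(1,2)[OF sol]
  note w' = bagley_torvik_solutionD(3)[OF sol] and v' = bagley_torvik_solutionD(4)[OF sol, folded f_def]
  note abel = bagley_torvik_solutionD(5)[OF sol, folded f_def]
  have f: "f absolutely_integrable_on {0..s}" if s: "s > 0" for s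
  proof -
    \<comment> \<open>\<open>f = f/\<surd>(s - \<tau>) \<cdot> \<surd>(s - \<tau>)\<close> away from \<open>\<tau> = s\<close>, and the second factor is bounded.\<close>
    have "(\<lambda>\<tau>. sqrt (s - \<tau>) * (f \<tau> / sqrt (s - \<tau>))) absolutely_integrable_on {0..s}"
    proof (rule absolutely_integrable_bounded_measurable_product_real[OF _ _ _ abel[OF s]])
      have cont: "continuous_on {0..s} (\<lambda>\<tau>. sqrt (s - \<tau>))" by (intro continuous_intros)
      show "(\<lambda>\<tau>. sqrt (s - \<tau>)) \<in> borel_measurable (lebesgue_on {0..s})"
        by (rule continuous_imp_measurable_on_sets_lebesgue[OF cont]) simp
      show "bounded ((\<lambda>\<tau>. sqrt (s - \<tau>)) ` {0..s})"
        by (intro compact_imp_bounded compact_continuous_image[OF cont]) simp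
    qed simp
    then show ?thesis
      by (rule absolutely_integrable_spike[of _ _ "{s}"]) auto
  qed
  let ?J = "\<lambda>s. integral {0..s} (\<lambda>\<tau>. \<bar>f \<tau> / sqrt (s - \<tau>)\<bar>)"
  have absI: "(\<lambda>x. \<bar>g x\<bar>) integrable_on {0<..<s}"
    if "g absolutely_integrable_on {0..s}" for g :: "real \<Rightarrow> real" and s
    using that by (simp add: absolutely_integrable_on_def integrable_on_Icc_iff_Ioo[symmetric])
  have L1_le: "integral {0..s} (\<lambda>\<tau>. \<bar>f \<tau>\<bar>) \<le> sqrt s * ?J s" if s: "s > 0" for s
  proof -
    have "integral {0<..<s} (\<lambda>\<tau>. \<bar>f \<tau>\<bar>) \<le> integral {0<..<s} (\<lambda>\<tau>. sqrt s * \<bar>f \<tau> / sqrt (s - \<tau>)\<bar>)"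
    proof (rule integral_le[OF absI[OF f[OF s]]])
      show "(\<lambda>\<tau>. sqrt s * \<bar>f \<tau> / sqrt (s - \<tau>)\<bar>) integrable_on {0<..<s}"
        by (rule integrable_on_mult_right[OF absI[OF abel[OF s]]])
      fix \<tau> assume "\<tau> \<in> {0<..<s}"
      then have "1 \<le> sqrt s / sqrt (s - \<tau>)" by simp
      then have "\<bar>f \<tau>\<bar> * 1 \<le> \<bar>f \<tau>\<bar> * (sqrt s / sqrt (s - \<tau>))" by (intro mult_left_mono) auto
      then show "\<bar>f \<tau>\<bar> \<le> sqrt s * \<bar>f \<tau> / sqrt (s - \<tau>)\<bar>"
        using \<open>\<tau> \<in> {0<..<s}\<close> by (simp add: abs_divide mult.commute)
    qed
    also have "\<dots> = sqrt s * integral {0<..<s} (\<lambda>\<tau>. \<bar>f \<tau> / sqrt (s - \<tau>)\<bar>)"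
      by (rule integral_mult_right)
    finally show ?thesis unfolding integral_open_interval_real .
  qed
  have w_le: "\<bar>w s\<bar> \<le> s * integral {0..s} (\<lambda>\<tau>. \<bar>f \<tau>\<bar>)" if "s > 0" for s
    by (rule abs_le_mult_integral_second_derivative[OF w0 w' v' f[OF that] that])
  define C where "C = (\<bar>b\<bar> / sqrt pi + \<bar>c\<bar> * (t * sqrt t)) / \<bar>a\<bar>"
  have "integral {0..t} (\<lambda>\<tau>. \<bar>f \<tau>\<bar>) = 0"
  proof (rule Volterra_Abel_inequality_imp_zero[OF t, of C f])
    show "C \<ge> 0" using t by (simp add: C_def)
    show "(\<lambda>t. indicator {0<..} t * f t) \<in> borel_measurable borel"
      by (rule borel_measurable_derivative_on_halfline[OF v'])
    show "f absolutely_integrable_on {0..t}" by (rule f[OF t])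
    fix s assume s: "0 < s" "s < t"
    show "(\<lambda>\<tau>. f \<tau> / sqrt (s - \<tau>)) absolutely_integrable_on {0..s}" by (rule abel[OF s(1)])
    have J0: "?J s \<ge> 0"
      by (rule Henstock_Kurzweil_Integration.integral_nonneg)
        (use abel[OF s(1)] in \<open>auto simp: absolutely_integrable_on_def abs_divide\<close>)
    have cap: "\<bar>caputo_3_2 w s\<bar> \<le> 1 / sqrt pi * ?J s"
    proof -
      have "\<bar>integral {0..s} (\<lambda>\<tau>. f \<tau> / sqrt (s - \<tau>))\<bar> \<le> ?J s"
        using abel[OF s(1)] integral_norm_bound_integral[of "\<lambda>\<tau>. f \<tau> / sqrt (s - \<tau>)" "{0..s}"
            "\<lambda>\<tau>. \<bar>f \<tau> / sqrt (s - \<tau>)\<bar>"]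
        by (auto simp: absolutely_integrable_on_def)
      then show ?thesis
        unfolding caputo_3_2_def f_def[symmetric] Gamma_one_half_real
        by (simp add: abs_mult divide_right_mono)
    qed
    have "\<bar>w s\<bar> \<le> t * (sqrt t * ?J s)"
    proof -
      have "s * integral {0..s} (\<lambda>\<tau>. \<bar>f \<tau>\<bar>) \<le> s * (sqrt s * ?J s)"
        using L1_le[OF s(1)] s by (intro mult_left_mono) auto
      also have "\<dots> \<le> t * (sqrt t * ?J s)"
        using s J0 by (intro mult_mono mult_right_mono) auto
      finally show ?thesis using w_le[OF s(1)] by simp
    qed
    then have "\<bar>a\<bar> * \<bar>f s\<bar> \<le> \<bar>b\<bar> * (1 / sqrt pi * ?J s) + \<bar>c\<bar> * (t * (sqrt t * ?J s))"
    proof -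
      assume ws: "\<bar>w s\<bar> \<le> t * (sqrt t * ?J s)"
      have "a * f s = - (b * caputo_3_2 w s + c * w s)"
        using bagley_torvik_solutionD(6)[OF sol s(1)] by (simp add: f_def)
      then have "\<bar>a\<bar> * \<bar>f s\<bar> = \<bar>b * caputo_3_2 w s + c * w s\<bar>"
        by (simp flip: abs_mult)
      also have "\<dots> \<le> \<bar>b\<bar> * \<bar>caputo_3_2 w s\<bar> + \<bar>c\<bar> * \<bar>w s\<bar>"
        by (metis abs_mult abs_triangle_ineq)
      also have "\<dots> \<le> \<bar>b\<bar> * (1 / sqrt pi * ?J s) + \<bar>c\<bar> * (t * (sqrt t * ?J s))"
        by (intro add_mono mult_left_mono cap ws) auto
      finally show ?thesis .
    qed
    also have "\<dots> = \<bar>a\<bar> * C * ?J s"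
    proof -
      have "\<bar>a\<bar> * C = \<bar>b\<bar> / sqrt pi + \<bar>c\<bar> * (t * sqrt t)" using a by (simp add: C_def)
      then show ?thesis by (simp only: distrib_right) simp
    qed
    finally show "\<bar>f s\<bar> \<le> C * ?J s" using a by (metis mult.assoc mult_le_cancel_left_pos zero_less_abs_iff)
  qed
  then show ?thesis using w_le[OF t] by simp
qed

lemma bagley_torvik_solution_lincomb:
  assumes y: "bagley_torvik_solution a b c \<Omega> \<omega> y0 v0 y"
    and z: "bagley_torvik_solution a b c \<Omega>' \<omega> z0 u0 z"
  shows "bagley_torvik_solution a b c (\<Omega> + k * \<Omega>') \<omega> (y0 + k * z0) (v0 + k * u0) (\<lambda>t. y t + k * z t)"
proof -
  let ?w = "\<lambda>t. y t + k * z t"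
  note Dy = bagley_torvik_solutionD[OF y] and Dz = bagley_torvik_solutionD[OF z]
  have w': "(?w has_real_derivative deriv y t + k * deriv z t) (at t)" if "t > 0" for t
    using that by (intro DERIV_add DERIV_cmult Dy(3) Dz(3))
  then have dw: "deriv ?w t = deriv y t + k * deriv z t" if "t > 0" for t
    using that by (intro DERIV_imp_deriv)
  have w'': "(deriv ?w has_real_derivative deriv (deriv y) t + k * deriv (deriv z) t) (at t)" if "t > 0" for t
  proof (rule DERIV_cong_ev[THEN iffD2, OF refl _ refl])
    show "eventually (\<lambda>s. deriv ?w s = deriv y s + k * deriv z s) (nhds t)"
      using eventually_nhds_in_open[of "{0<..}" t] that by (auto elim!: eventually_mono simp: dw)
    show "((\<lambda>s. deriv y s + k * deriv z s) has_real_derivative deriv (deriv y) t + k * deriv (deriv z) t) (at t)"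
      using that by (intro DERIV_add DERIV_cmult Dy(4) Dz(4))
  qed
  then have ddw: "deriv (deriv ?w) t = deriv (deriv y) t + k * deriv (deriv z) t" if "t > 0" for t
    using that by (intro DERIV_imp_deriv)
  have frac: "deriv (deriv ?w) \<tau> / sqrt (t - \<tau>) =
      deriv (deriv y) \<tau> / sqrt (t - \<tau>) + k * (deriv (deriv z) \<tau> / sqrt (t - \<tau>))" if "\<tau> \<in> {0..t} - {0}" for \<tau> t
    using that by (simp add: ddw add_divide_distrib)
  note kz = set_integrable_mult_right[of k, OF Dz(5)]
  have ai: "(\<lambda>\<tau>. deriv (deriv ?w) \<tau> / sqrt (t - \<tau>)) absolutely_integrable_on {0..t}" if "t > 0" for t
    by (rule absolutely_integrable_spike[OF set_integral_add(1)[OF Dy(5)[OF that] kz[OF that]], of "{0}"])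
      (use frac in auto)
  have cap: "caputo_3_2 ?w t = caputo_3_2 y t + k * caputo_3_2 z t" if "t > 0" for t
  proof -
    have "integral {0..t} (\<lambda>\<tau>. deriv (deriv ?w) \<tau> / sqrt (t - \<tau>)) =
      integral {0..t} (\<lambda>\<tau>. deriv (deriv y) \<tau> / sqrt (t - \<tau>) + k * (deriv (deriv z) \<tau> / sqrt (t - \<tau>)))"
      by (rule integral_spike[of "{0}"]) (use frac in auto)
    also have "\<dots> = integral {0..t} (\<lambda>\<tau>. deriv (deriv y) \<tau> / sqrt (t - \<tau>)) +
        integral {0..t} (\<lambda>\<tau>. k * (deriv (deriv z) \<tau> / sqrt (t - \<tau>)))"
      using Dy(5)[OF that] kz[OF that]
      by (intro integral_add) (auto simp: absolutely_integrable_on_def)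
    also have "integral {0..t} (\<lambda>\<tau>. k * (deriv (deriv z) \<tau> / sqrt (t - \<tau>))) =
        k * integral {0..t} (\<lambda>\<tau>. deriv (deriv z) \<tau> / sqrt (t - \<tau>))"
      by (rule integral_mult_right)
    finally show ?thesis by (simp only: caputo_3_2_def distrib_left mult.left_commute)
  qed
  show ?thesis
    unfolding bagley_torvik_solution_def
  proof (intro conjI allI impI)
    fix t :: real assume t: "t > 0"
    show "a * deriv (deriv ?w) t + b * caputo_3_2 ?w t + c * ?w t = (\<Omega> + k * \<Omega>') * sin (\<omega> * t)"
    proof -
      have "a * deriv (deriv ?w) t + b * caputo_3_2 ?w t + c * ?w t =
          (a * deriv (deriv y) t + b * caputo_3_2 y t + c * y t) +
          k * (a * deriv (deriv z) t + b * caputo_3_2 z t + c * z t)"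
        by (simp add: ddw[OF t] cap[OF t] algebra_simps)
      then show ?thesis by (simp only: Dy(6)[OF t] Dz(6)[OF t] distrib_right mult.assoc)
    qed
    show "?w differentiable at t" "deriv ?w differentiable at t"
      using w'[OF t] w''[OF t] by (auto simp: real_differentiable_def)
  qed (use Dy(1,2) Dz(1,2) ai in \<open>auto intro!: DERIV_add DERIV_cmult\<close>)
qed

lemma bagley_torvik_solution_unique:
  assumes "a \<noteq> 0" "bagley_torvik_solution a b c \<Omega> \<omega> y0 v0 y" "bagley_torvik_solution a b c \<Omega> \<omega> y0 v0 z" "t \<ge> 0"
  shows "y t = z t"
  using homogeneous_solution_eq_zero[OF assms(1), of b c \<omega> "\<lambda>t. y t + (-1) * z t" t]
    bagley_torvik_solution_lincomb[OF assms(2,3), of "-1"] assms(4) by simp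

section \<open>The error function and the Fresnel integrals\<close>

lemma erfc_add_erfc_minus: "erfc z + erfc (- z) = 2"
proof -
  have "((\<lambda>z. erfc z + erfc (- z)) has_field_derivative 0) (at z)" for z
  proof -
    have "((\<lambda>z. erfc z + erfc (- z)) has_field_derivative
        - 2 / of_real (sqrt pi) * exp (- (z\<^sup>2)) + - 2 / of_real (sqrt pi) * exp (- ((- z)\<^sup>2)) * - 1) (at z)"
      by (intro DERIV_add erfc_has_field_derivative DERIV_chain2[OF erfc_has_field_derivative])
        (auto intro!: derivative_eq_intros)
    then show ?thesis by simp
  qed
  then obtain k where k: "\<And>z. erfc z + erfc (- z) = k"
    using has_field_derivative_zero_constant[of UNIV "\<lambda>z. erfc z + erfc (- z)"] by auto
  from k[of 0] k[of z] show ?thesis by simp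
qed

lemma exp_erfc_add_exp_erfc_minus:
  "exp_erfc p x + exp_erfc (- p) x = 2 * exp (p\<^sup>2 * x\<^sup>2)"
proof -
  have "exp_erfc p x + exp_erfc (- p) x = exp (p\<^sup>2 * x\<^sup>2) * (erfc (p * x) + erfc (- (p * x)))"
    by (simp add: exp_erfc_def distrib_left add.commute)
  then show ?thesis by (simp only: erfc_add_erfc_minus mult.commute)
qed

lemma exp_erfc_diff_exp_erfc_minus:
  "exp_erfc p x - exp_erfc (- p) x = 2 * exp (p\<^sup>2 * x\<^sup>2) * (1 - erfc (p * x))"
proof -
  have e: "erfc (- (p * x)) = 2 - erfc (p * x)"
    using erfc_add_erfc_minus[of "p * x"] by (simp add: eq_diff_eq add.commute)
  show ?thesis by (simp add: exp_erfc_def e algebra_simps)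
qed

text \<open>Divided by \<open>p\<close>, both sides vanish at 0 and have the derivative \<open>2/\<surd>\<pi> exp (-\<sigma> i w x\<^sup>2)\<close>. The
  square root \<open>q\<close> of \<open>w\<close> is arbitrary because the Fresnel integrals are odd.\<close>

lemma erf_eq_fresnel:
  fixes w p q x \<sigma> :: complex
  assumes q: "q\<^sup>2 = w" "q \<noteq> 0" and \<sigma>: "\<sigma> = 1 \<or> \<sigma> = - 1" and p: "p\<^sup>2 = \<sigma> * \<i> * w"
  defines "\<kappa> \<equiv> q * of_real (sqrt (2 / pi))"
  shows "1 - erfc (p * x) = p * (of_real (sqrt 2) / q * (fresnel_C (\<kappa> * x) - \<sigma> * \<i> * fresnel_S (\<kappa> * x)))"
proof -
  have \<kappa>2: "of_real pi * (\<kappa> * x)\<^sup>2 / 2 = w * x\<^sup>2" for x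
  proof -
    have "complex_of_real (sqrt (2 / pi))^2 = of_real (2 / pi)"
      by (simp flip: of_real_power)
    then show ?thesis by (simp add: \<kappa>_def power_mult_distrib q)
  qed
  have \<kappa>1: "of_real (sqrt 2) / q * \<kappa> = 2 / of_real (sqrt pi)"
    using q by (simp add: \<kappa>_def real_sqrt_divide flip: of_real_mult)
  have C: "((\<lambda>x. fresnel_C (\<kappa> * x)) has_field_derivative cos (w * x\<^sup>2) * \<kappa>) (at x)" for x
  proof -
    have "(fresnel_C has_field_derivative cos (of_real pi * (\<kappa> * x)\<^sup>2 / 2)) (at (\<kappa> * x))"
      unfolding fresnel_C_def by (rule has_field_derivative_line_integral) (intro holomorphic_intros, simp)
    then show ?thesis
      unfolding \<kappa>2 by (rule DERIV_chain2) (auto intro!: derivative_eq_intros)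
  qed
  have S: "((\<lambda>x. fresnel_S (\<kappa> * x)) has_field_derivative sin (w * x\<^sup>2) * \<kappa>) (at x)" for x
  proof -
    have "(fresnel_S has_field_derivative sin (of_real pi * (\<kappa> * x)\<^sup>2 / 2)) (at (\<kappa> * x))"
      unfolding fresnel_S_def by (rule has_field_derivative_line_integral) (intro holomorphic_intros, simp)
    then show ?thesis
      unfolding \<kappa>2 by (rule DERIV_chain2) (auto intro!: derivative_eq_intros)
  qed
  let ?F = "\<lambda>x. 1 - erfc (p * x) - p * (of_real (sqrt 2) / q * (fresnel_C (\<kappa> * x) - \<sigma> * \<i> * fresnel_S (\<kappa> * x)))"
  have "(?F has_field_derivative 0) (at x)" for x
  proof -
    have "((\<lambda>x. erfc (p * x)) has_field_derivative - 2 / of_real (sqrt pi) * exp (- ((p * x)\<^sup>2)) * p) (at x)"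
      by (rule DERIV_chain2[OF erfc_has_field_derivative]) (auto intro!: derivative_eq_intros)
    then have "(?F has_field_derivative 0 - - 2 / of_real (sqrt pi) * exp (- ((p * x)\<^sup>2)) * p -
        p * (of_real (sqrt 2) / q * (cos (w * x\<^sup>2) * \<kappa> - \<sigma> * \<i> * (sin (w * x\<^sup>2) * \<kappa>)))) (at x)"
      by (intro DERIV_diff DERIV_const DERIV_cmult C S)
    moreover have "exp (- ((p * x)\<^sup>2)) = cos (w * x\<^sup>2) - \<sigma> * \<i> * sin (w * x\<^sup>2)"
    proof -
      have "- ((p * x)\<^sup>2) = \<i> * (- \<sigma> * (w * x\<^sup>2))" by (simp add: power_mult_distrib p)
      then have "exp (- ((p * x)\<^sup>2)) = cos (- \<sigma> * (w * x\<^sup>2)) + \<i> * sin (- \<sigma> * (w * x\<^sup>2))"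
        by (simp only: exp_Euler)
      then show ?thesis using \<sigma> by auto
    qed
    moreover have "of_real (sqrt 2) / q * (y * \<kappa> - z * (y' * \<kappa>)) = 2 / of_real (sqrt pi) * (y - z * y')" for y z y'
    proof -
      have "of_real (sqrt 2) / q * (y * \<kappa> - z * (y' * \<kappa>)) = (of_real (sqrt 2) / q * \<kappa>) * (y - z * y')"
        by (simp add: algebra_simps diff_divide_distrib)
      then show ?thesis by (simp only: \<kappa>1)
    qed
    ultimately have "(?F has_field_derivative 0 - - 2 / of_real (sqrt pi) * (cos (w * x\<^sup>2) - \<sigma> * \<i> * sin (w * x\<^sup>2)) * p -
        p * (2 / of_real (sqrt pi) * (cos (w * x\<^sup>2) - \<sigma> * \<i> * sin (w * x\<^sup>2)))) (at x)"
      by (simp only:)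
    moreover have "0 - - 2 / k * e * p - p * (2 / k * e) = 0" for k e :: complex by simp
    ultimately show ?thesis by (simp only:)
  qed
  then obtain k where k: "\<And>x. ?F x = k"
    using has_field_derivative_zero_constant[of UNIV ?F] by auto
  have "?F 0 = 0" by (simp add: fresnel_C_def fresnel_S_def)
  then have "?F x = 0" using k by metis
  then show ?thesis by simp
qed



section \<open>The explicit solution\<close>

lemma poly_bt_poly: "poly (bt_poly a b c) z = of_real a * z ^ 4 + of_real b * z ^ 3 + of_real c"
  by (simp add: bt_poly_def algebra_simps power3_eq_cube power4_eq_xxxx)

lemma poly_pderiv_bt_poly:
  "poly (pderiv (bt_poly a b c)) z = z\<^sup>2 * (4 * of_real a * z + 3 * of_real b)"
  by (simp add: bt_poly_def pderiv_pCons algebra_simps power2_eq_square)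

lemma degree_bt_poly: "a \<noteq> 0 \<Longrightarrow> degree (bt_poly a b c) = 4"
  by (simp add: bt_poly_def)

lemma sum_over_bt_roots:
  assumes "card {z. poly (bt_poly a b c) z = 0} = 4" and "degree p \<le> 3"
  shows "(\<Sum>z | poly (bt_poly a b c) z = 0. poly p z / poly (pderiv (bt_poly a b c)) z) = coeff p 3 / of_real a"
proof -
  have "degree (bt_poly a b c) = 4" by (rule degree_bt_poly[OF bt_poly_coeffs_nonzero(1)[OF assms(1)]])
  moreover have "lead_coeff (bt_poly a b c) = of_real a"
    using bt_poly_coeffs_nonzero(1)[OF assms(1)] by (simp add: bt_poly_def)
  ultimately show ?thesis
    using sum_over_roots_div_pderiv[of "bt_poly a b c" p] assms by simp
qed

lemma sum_bt_root:
  assumes "card {z. poly (bt_poly a b c) z = 0} = 4"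
  shows "(\<Sum>k=1..4. f (bt_root a b c k)) = (\<Sum>z | poly (bt_poly a b c) z = 0. f z)"
  by (rule sum.reindex_bij_betw[OF bij_betw_bt_root[OF assms]])

lemma exp_erfc_sqrt:
  "t \<ge> 0 \<Longrightarrow> exp (z\<^sup>2 * of_real t) * erfc (- z * of_real (sqrt t)) = exp_erfc z (of_real (sqrt t))"
  by (simp add: exp_erfc_def flip: of_real_power)

text \<open>The residue at \<open>z\<close> of \<open>(a X + b)(X\<^sup>2 y0 + v0)/P(X)\<close>.\<close>

definition bt_yc_coeff :: "real \<Rightarrow> real \<Rightarrow> real \<Rightarrow> real \<Rightarrow> real \<Rightarrow> complex \<Rightarrow> complex" where
  "bt_yc_coeff a b c y0 v0 z =
     (of_real a * z + of_real b) * (z\<^sup>2 * of_real y0 + of_real v0) / poly (pderiv (bt_poly a b c)) z"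

lemma bt_yc_eq_exp_erfc_sum:
  assumes "card {z. poly (bt_poly a b c) z = 0} = 4" and "t \<ge> 0"
  shows "bt_yc a b y0 v0 (bt_root a b c) t =
    exp_erfc_sum {z. poly (bt_poly a b c) z = 0} (bt_yc_coeff a b c y0 v0) t"
proof -
  have "bt_yc a b y0 v0 (bt_root a b c) t = (\<Sum>k=1..4. bt_yc_coeff a b c y0 v0 (bt_root a b c k) *
      exp_erfc (bt_root a b c k) (of_real (sqrt t)))"
    unfolding bt_yc_def bt_yc_coeff_def poly_pderiv_bt_poly exp_erfc_sqrt[OF assms(2), symmetric]
    by (simp only: mult.commute mult.assoc)
  then show ?thesis
    unfolding exp_erfc_sum_def
      sum_bt_root[OF assms(1), of "\<lambda>z. bt_yc_coeff a b c y0 v0 z * exp_erfc z (of_real (sqrt t))"] .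
qed

text \<open>At a root, \<open>(a z + b) z\<^sup>3 = - c\<close>. This lowers the degree of the numerators
  \<open>(a z + b)(z\<^sup>2 y0 + v0) z\<^sup>m\<close> to at most three, and the moments are then read off from the coefficient
  of \<open>z\<^sup>3\<close>.\<close>

lemma bt_yc_solution:
  fixes L :: "complex \<Rightarrow> real"
  assumes four: "card {z. poly (bt_poly a b c) z = 0} = 4" and L: "bounded_linear L"
  shows "bagley_torvik_solution a b c 0 \<omega> (y0 * L 1) (v0 * L 1)
    (\<lambda>t. L (exp_erfc_sum {z. poly (bt_poly a b c) z = 0} (bt_yc_coeff a b c y0 v0) t))"
proof -
  let ?P = "bt_poly a b c" and ?\<alpha> = "bt_yc_coeff a b c y0 v0"
  let ?A = "{z. poly ?P z = 0}"
  let ?a = "complex_of_real a" and ?b = "complex_of_real b" and ?c = "complex_of_real c"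
    and ?y = "complex_of_real y0" and ?v = "complex_of_real v0"
  note ac = bt_poly_coeffs_nonzero[OF four]
  have root: "?c = - ((?a * z + ?b) * z ^ 3)" if "z \<in> ?A" for z
    using that by (simp add: poly_bt_poly eq_neg_iff_add_eq_0 algebra_simps power3_eq_cube power4_eq_xxxx)
  have moment: "(\<Sum>z\<in>?A. ?\<alpha> z * g z) = coeff p 3 / ?a"
    if "degree p \<le> 3" and "\<And>z. z \<in> ?A \<Longrightarrow> (?a * z + ?b) * (z\<^sup>2 * ?y + ?v) * g z = poly p z" for p g
  proof -
    have "(\<Sum>z\<in>?A. ?\<alpha> z * g z) = (\<Sum>z\<in>?A. poly p z / poly (pderiv ?P) z)"
      by (rule sum.cong) (simp_all add: bt_yc_coeff_def flip: that(2))
    then show ?thesis using sum_over_bt_roots[OF four that(1)] by simp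
  qed
  have "bagley_torvik_solution a b c (0 * L 1) \<omega> (y0 * L 1) (v0 * L 1) (\<lambda>t. L (exp_erfc_sum ?A ?\<alpha> t))"
  proof (rule exp_erfc_sum_solution[OF L])
    show "finite ?A" using four by (simp add: card_ge_0_finite)
    show "0 \<notin> ?A" using ac by (simp add: poly_bt_poly)
    show "sum ?\<alpha> ?A = ?y"
      using moment[of "[:?b * ?v, ?a * ?v, ?b * ?y, ?a * ?y:]" "\<lambda>_. 1"] ac
      by (simp add: algebra_simps power2_eq_square numeral_3_eq_3)
    show "(\<Sum>z\<in>?A. ?\<alpha> z * z) = 0"
      using moment[of "[:- ?c * ?y, ?b * ?v, ?a * ?v:]" "\<lambda>z. z"] ac
      by (simp add: root algebra_simps power2_eq_square power3_eq_cube numeral_3_eq_3)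
    show "(\<Sum>z\<in>?A. ?\<alpha> z * z\<^sup>2) = ?v"
      using moment[of "[:0, - ?c * ?y, ?b * ?v, ?a * ?v:]" "\<lambda>z. z\<^sup>2"] ac
      by (simp add: root algebra_simps power2_eq_square power3_eq_cube numeral_3_eq_3)
    show "(\<Sum>z\<in>?A. ?\<alpha> z * z ^ 3) = 0"
      using moment[of "[:- ?c * ?v, 0, - ?c * ?y:]" "\<lambda>z. z ^ 3"] ac
      by (simp add: root algebra_simps power2_eq_square power3_eq_cube numeral_3_eq_3)
    show "exp_erfc_sum ?A (\<lambda>z. ?\<alpha> z * poly ?P z) t = of_real (0 * sin (\<omega> * t))" for t
      unfolding exp_erfc_sum_def by (subst sum.neutral) auto
  qed
  then show ?thesis by simp
qed

lemma fourth_roots_of_minus_square: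
  assumes w: "w \<noteq> (0::complex)" and p: "p\<^sup>2 = \<i> * w" and q: "q\<^sup>2 = - \<i> * w"
  shows "{z. w\<^sup>2 + z ^ 4 = 0} = {p, - p, q, - q}" and "card {p, - p, q, - q} = 4"
proof -
  have "w\<^sup>2 + z ^ 4 = (z - p) * (z + p) * ((z - q) * (z + q))" for z
  proof -
    have "(z - p) * (z + p) * ((z - q) * (z + q)) = (z\<^sup>2 - p\<^sup>2) * (z\<^sup>2 - q\<^sup>2)"
      by (simp add: power2_eq_square algebra_simps)
    then show ?thesis unfolding p q
      by (simp add: algebra_simps power2_eq_square power4_eq_xxxx)
  qed
  then show "{z. w\<^sup>2 + z ^ 4 = 0} = {p, - p, q, - q}"
    by (auto simp: eq_neg_iff_add_eq_0)
  have "p\<^sup>2 - q\<^sup>2 = 2 * \<i> * w" unfolding p q by simp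
  then have "p\<^sup>2 \<noteq> q\<^sup>2" using w by auto
  then have "p \<noteq> q" "p \<noteq> - q" "- p \<noteq> q" by auto
  moreover have "p \<noteq> 0" "q \<noteq> 0" using w p q by auto
  then have "p \<noteq> - p" "q \<noteq> - q" by (simp_all add: eq_neg_iff_add_eq_0 flip: mult_2)
  ultimately show "card {p, - p, q, - q} = 4" by auto
qed

text \<open>Expand \<open>1/P(z)\<close> into partial fractions and use
  \<open>(z - r)(z\<^sup>3 + z\<^sup>2 r + z r\<^sup>2 + r\<^sup>3) = z\<^sup>4 - r\<^sup>4 = - (\<omega>\<^sup>2 + r\<^sup>4)\<close>. Division by \<open>P'(r) = r\<^sup>2 (4 a r + 3 b)\<close>
  produces the constants with indices from \<open>-2\<close> to \<open>1\<close>.\<close>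

lemma inverse_bt_poly_at_pole:
  assumes four: "card {z. poly (bt_poly a b c) z = 0} = 4"
    and nonres: "\<And>z. poly (bt_poly a b c) z = 0 \<Longrightarrow> (of_real \<omega>)\<^sup>2 + z ^ 4 \<noteq> 0"
    and z: "(of_real \<omega>)\<^sup>2 + z ^ 4 = 0" "z \<noteq> 0"
  defines "B \<equiv> bt_B a b \<omega> (bt_root a b c)"
  shows "1 / poly (bt_poly a b c) z = - (B 2 / z + z\<^sup>2 * B (-1) + z * B 0 + B 1)"
proof -
  let ?P = "bt_poly a b c" and ?w = "complex_of_real \<omega>"
  let ?A = "{z. poly ?P z = 0}"
  note ac = bt_poly_coeffs_nonzero[OF four]
  have r0: "r \<noteq> 0" if "r \<in> ?A" for r using that ac by (auto simp: poly_bt_poly)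
  define W where "W r = 1 / ((4 * of_real a * r + 3 * of_real b) * (?w\<^sup>2 + r ^ 4))" for r :: complex
  have B: "B m = (\<Sum>r\<in>?A. r powi m * W r)" for m
    unfolding B_def bt_B_def W_def
    using sum_bt_root[OF four, of "\<lambda>r. r powi m / ((4 * of_real a * r + 3 * of_real b) * (?w\<^sup>2 + r ^ 4))"]
    by simp
  define B' where "B' = (\<Sum>r\<in>?A. W r / r\<^sup>2)"
  have z4: "z ^ 4 = - ?w\<^sup>2" using z by (simp add: eq_neg_iff_add_eq_0 add.commute)
  have D: "1 / poly (pderiv ?P) r = (?w\<^sup>2 + r ^ 4) * (W r / r\<^sup>2)" if "r \<in> ?A" for r
    using nonres[of r] that by (simp add: W_def poly_pderiv_bt_poly)
  \<comment> \<open>The vanishing sum \<open>\<Sum> 1/P'(r)\<close> expresses the constant with index \<open>-2\<close> by the one with index \<open>2\<close>.\<close>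
  have "?w\<^sup>2 * B' + B 2 = (\<Sum>r\<in>?A. 1 / poly (pderiv ?P) r)"
    unfolding B'_def B sum_distrib_left sum.distrib[symmetric]
  proof (rule sum.cong[OF refl])
    fix r assume r: "r \<in> ?A"
    have "r powi 2 * W r = r ^ 4 * (W r / r\<^sup>2)"
      using r0[OF r] by (simp add: power2_eq_square power4_eq_xxxx)
    then show "?w\<^sup>2 * (W r / r\<^sup>2) + r powi 2 * W r = 1 / poly (pderiv ?P) r"
      by (simp only: D[OF r] distrib_right)
  qed
  also have "\<dots> = 0" using sum_over_bt_roots[OF four, of 1] by simp
  finally have B': "B 2 = - ?w\<^sup>2 * B'" by (simp add: eq_neg_iff_add_eq_0 add.commute)
  have "poly ?P z \<noteq> 0" using nonres z by blast
  then have "1 / poly ?P z = (\<Sum>r\<in>?A. 1 / (poly (pderiv ?P) r * (z - r)))"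
    using partial_fractions_at_roots[of ?P 1 z] degree_bt_poly[OF ac(1)] four by simp
  also have "\<dots> = (\<Sum>r\<in>?A. - (z ^ 3 * (W r / r\<^sup>2) + z\<^sup>2 * (r powi (-1) * W r) + z * (r powi 0 * W r) + r powi 1 * W r))"
  proof (rule sum.cong[OF refl])
    fix r assume r: "r \<in> ?A"
    have zr: "z \<noteq> r" using \<open>poly ?P z \<noteq> 0\<close> r by auto
    have "(z ^ 3 + z\<^sup>2 * r + z * r\<^sup>2 + r ^ 3) * (z - r) = z ^ 4 - r ^ 4"
      by (simp add: algebra_simps power2_eq_square power3_eq_cube power4_eq_xxxx)
    also have "\<dots> = - (?w\<^sup>2 + r ^ 4)" by (simp add: z4)
    finally have "?w\<^sup>2 + r ^ 4 = - (z ^ 3 + z\<^sup>2 * r + z * r\<^sup>2 + r ^ 3) * (z - r)"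
      by (metis minus_minus mult_minus_left)
    then have "(?w\<^sup>2 + r ^ 4) / (z - r) = - (z ^ 3 + z\<^sup>2 * r + z * r\<^sup>2 + r ^ 3)"
      using zr by simp
    moreover have "1 / (poly (pderiv ?P) r * (z - r)) = (?w\<^sup>2 + r ^ 4) / (z - r) * (W r / r\<^sup>2)"
    proof -
      have "1 / (poly (pderiv ?P) r * (z - r)) = 1 / poly (pderiv ?P) r * (1 / (z - r))" by simp
      also have "\<dots> = (?w\<^sup>2 + r ^ 4) * (W r / r\<^sup>2) * (1 / (z - r))" by (simp only: D[OF r])
      also have "u * v * (1 / d) = u / d * v" for u v d :: complex by simp
      finally show ?thesis .
    qed
    ultimately have "1 / (poly (pderiv ?P) r * (z - r)) = - (z ^ 3 + z\<^sup>2 * r + z * r\<^sup>2 + r ^ 3) * (W r / r\<^sup>2)"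
      by simp
    also have "\<dots> = - (z ^ 3 * (W r / r\<^sup>2) + z\<^sup>2 * (r powi (-1) * W r) + z * (r powi 0 * W r) + r powi 1 * W r)"
    proof -
      have "r powi (-1) * W r = r * (W r / r\<^sup>2)" "r powi 0 * W r = r\<^sup>2 * (W r / r\<^sup>2)"
        "r powi 1 * W r = r ^ 3 * (W r / r\<^sup>2)"
        using r0[OF r] by (simp_all add: power2_eq_square power3_eq_cube power_int_minus field_simps)
      then show ?thesis by (simp only: distrib_right mult_minus_left mult.assoc)
    qed
    finally show "1 / (poly (pderiv ?P) r * (z - r)) = - (z ^ 3 * (W r / r\<^sup>2) + z\<^sup>2 * (r powi (-1) * W r) + z * (r powi 0 * W r) + r powi 1 * W r)" .
  qed
  also have "\<dots> = - (z ^ 3 * B' + z\<^sup>2 * B (-1) + z * B 0 + B 1)"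
    unfolding B B'_def sum_distrib_left sum_negf sum.distrib by simp
  also have "z ^ 3 * B' = B 2 / z"
  proof -
    have "z ^ 3 * B' * z = z ^ 4 * B'" by (simp add: power3_eq_cube power4_eq_xxxx)
    also have "\<dots> = B 2" by (simp add: z4 B')
    finally show ?thesis using z(2) by (simp add: eq_divide_eq)
  qed
  finally show ?thesis .
qed


lemma sum_over_four:
  assumes "card {p, - p, q, - q :: complex} = 4"
  shows "(\<Sum>z\<in>{p, - p, q, - q}. f z) = f p + f (- p) + (f q + f (- q) :: complex)"
proof -
  have "p \<noteq> - p" "q \<noteq> - q" "p \<notin> {q, - q}" "- p \<notin> {q, - q}"
    using assms by (auto simp: card_insert_if split: if_splits)
  then show ?thesis by (simp add: add.assoc)
qed

lemma poly_pole_factor: "poly [:v, 0, 0, 0, 1:] z = v + z ^ 4" for v z :: complex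
  by (simp add: power4_eq_xxxx mult.assoc)

text \<open>The residue at \<open>z\<close> of \<open>\<Omega> \<omega> X/Q(X)\<close> with \<open>Q = P (X\<^sup>4 + \<omega>\<^sup>2)\<close>.\<close>

definition bt_yf_coeff :: "real \<Rightarrow> real \<Rightarrow> real \<Rightarrow> real \<Rightarrow> real \<Rightarrow> complex \<Rightarrow> complex" where
  "bt_yf_coeff a b c \<Omega> \<omega> z =
     of_real (\<Omega> * \<omega>) * z / poly (pderiv (bt_poly a b c * [:(of_real \<omega>)\<^sup>2, 0, 0, 0, 1:])) z"

lemma bt_yf_coeff_at_root:
  assumes "poly (bt_poly a b c) z = 0"
  shows "bt_yf_coeff a b c \<Omega> \<omega> z =
    of_real (\<Omega> * \<omega>) * z / (poly (pderiv (bt_poly a b c)) z * ((of_real \<omega>)\<^sup>2 + z ^ 4))"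
proof -
  show ?thesis
    unfolding bt_yf_coeff_def pderiv_mult poly_add poly_mult poly_pole_factor using assms by (simp only: mult.commute mult_zero_left mult_zero_right add_0)
qed

lemma bt_yf_coeff_at_pole:
  assumes "(of_real \<omega>)\<^sup>2 + z ^ 4 = 0" and "z \<noteq> 0"
  shows "bt_yf_coeff a b c \<Omega> \<omega> z = of_real (\<Omega> * \<omega>) / (4 * z\<^sup>2) * (1 / poly (bt_poly a b c) z)"
proof -
  have "poly [:(of_real \<omega>)\<^sup>2, 0, 0, 0, 1:] z = 0"
    using assms(1) by (simp only: poly_pole_factor)
  moreover have "poly (pderiv [:(of_real \<omega>)\<^sup>2, 0, 0, 0, 1:]) z = 4 * z ^ 3"
    by (simp add: pderiv_pCons power3_eq_cube)
  ultimately have "poly (pderiv (bt_poly a b c * [:(of_real \<omega>)\<^sup>2, 0, 0, 0, 1:])) z =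
      poly (bt_poly a b c) z * (4 * z ^ 3)"
    unfolding pderiv_mult poly_add poly_mult by simp
  then show ?thesis
    unfolding bt_yf_coeff_def using assms(2) by (simp add: power2_eq_square power3_eq_cube)
qed

text \<open>The moments vanish because \<open>Q\<close> has degree 8. Multiplication by \<open>P(z)\<close> kills the terms at the
  roots of \<open>P\<close>. At the fourth roots of \<open>-\<omega>\<^sup>2\<close> it leaves the coefficients \<open>\<Omega> \<omega>/(4 z\<^sup>2)\<close>, which are equal at
  \<open>z\<close> and \<open>- z\<close>, so only the exponentials \<open>exp (\<plusminus>i\<omega>t)\<close> remain.\<close>

lemma bt_yf_solution:
  fixes L :: "complex \<Rightarrow> real"
  assumes four: "card {z. poly (bt_poly a b c) z = 0} = 4"
    and nonres: "\<And>z. poly (bt_poly a b c) z = 0 \<Longrightarrow> (of_real \<omega>)\<^sup>2 + z ^ 4 \<noteq> 0"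
    and \<omega>: "\<omega> \<noteq> 0" and L: "bounded_linear L"
  defines "Z \<equiv> {z. poly (bt_poly a b c) z = 0} \<union> {z. (of_real \<omega>)\<^sup>2 + z ^ 4 = 0}"
  shows "bagley_torvik_solution a b c (\<Omega> * L 1) \<omega> 0 0 (\<lambda>t. L (exp_erfc_sum Z (bt_yf_coeff a b c \<Omega> \<omega>) t))"
proof -
  let ?w = "complex_of_real \<omega>" and ?P = "bt_poly a b c" and ?\<alpha> = "bt_yf_coeff a b c \<Omega> \<omega>"
  let ?A = "{z. poly ?P z = 0}" and ?D = "{z. ?w\<^sup>2 + z ^ 4 = 0}"
  define Q where "Q = ?P * [:?w\<^sup>2, 0, 0, 0, 1:]"
  note ac = bt_poly_coeffs_nonzero[OF four]
  define p q where "p = csqrt (\<i> * ?w)" and "q = csqrt (- \<i> * ?w)"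
  have pq: "p\<^sup>2 = \<i> * ?w" "q\<^sup>2 = - \<i> * ?w" by (simp_all add: p_def q_def)
  have w0: "?w \<noteq> 0" using \<omega> by simp
  note D = fourth_roots_of_minus_square[OF w0 pq]
  have Z: "{z. poly Q z = 0} = Z"
    unfolding Q_def Z_def poly_mult poly_pole_factor mult_eq_0_iff by auto
  have finA: "finite ?A" using four by (simp add: card_ge_0_finite)
  have "card Z = card ?A + card ?D"
    unfolding Z_def using finA D(1) nonres by (intro card_Un_disjoint) auto
  then have "card Z = 8" using four D by simp
  moreover have "degree Q = 8"
    using ac unfolding Q_def by (subst degree_mult_eq) (auto simp: bt_poly_def)
  ultimately have card: "card {z. poly Q z = 0} = degree Q" by (simp add: Z)
  have \<alpha>: "?\<alpha> z = of_real (\<Omega> * \<omega>) * z / poly (pderiv Q) z" for z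
    by (simp only: bt_yf_coeff_def Q_def)
  have moment: "(\<Sum>z\<in>Z. ?\<alpha> z * z ^ m) = 0" if "m < 6" for m
  proof -
    have "(\<Sum>z\<in>Z. ?\<alpha> z * z ^ m) = of_real (\<Omega> * \<omega>) * (\<Sum>z\<in>Z. poly (monom 1 (Suc m)) z / poly (pderiv Q) z)"
      unfolding sum_distrib_left by (rule sum.cong) (simp_all add: \<alpha> poly_monom)
    also have "(\<Sum>z\<in>Z. poly (monom 1 (Suc m)) z / poly (pderiv Q) z) = 0"
      using sum_over_roots_div_pderiv[OF card, of "monom 1 (Suc m)"] that \<open>degree Q = 8\<close>
      by (simp add: Z degree_monom_eq)
    finally show ?thesis by simp
  qed
  have Z0: "0 \<notin> Z" using ac \<omega> by (simp add: Z_def poly_bt_poly)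
  have finZ: "finite Z" using \<open>card Z = 8\<close> by (simp add: card_ge_0_finite)
  have "bagley_torvik_solution a b c (\<Omega> * L 1) \<omega> (0 * L 1) (0 * L 1) (\<lambda>t. L (exp_erfc_sum Z ?\<alpha> t))"
  proof (rule exp_erfc_sum_solution[OF L finZ Z0])
    show "sum ?\<alpha> Z = of_real 0" "(\<Sum>z\<in>Z. ?\<alpha> z * z) = 0" "(\<Sum>z\<in>Z. ?\<alpha> z * z\<^sup>2) = of_real 0"
      "(\<Sum>z\<in>Z. ?\<alpha> z * z ^ 3) = 0"
      using moment[of 0] moment[of 1] moment[of 2] moment[of 3] by simp_all
    fix t :: real assume t: "t > 0"
    let ?x = "complex_of_real (sqrt t)"
    have x2: "?x\<^sup>2 = of_real t" using t by (simp flip: of_real_power)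
    have \<alpha>P: "?\<alpha> z * poly ?P z = of_real (\<Omega> * \<omega>) / (4 * z\<^sup>2)" if "z \<in> ?D" for z
    proof -
      have "z \<noteq> 0" using that \<omega> by auto
      moreover have "poly ?P z \<noteq> 0" using nonres that by blast
      ultimately show ?thesis using that by (simp add: bt_yf_coeff_at_pole)
    qed
    have "exp_erfc_sum Z (\<lambda>z. ?\<alpha> z * poly ?P z) t = (\<Sum>z\<in>?D. of_real (\<Omega> * \<omega>) / (4 * z\<^sup>2) * exp_erfc z ?x)"
      unfolding exp_erfc_sum_def Z_def
      by (rule sum.mono_neutral_cong_right) (use finA D(1) \<alpha>P in auto)
    also have "\<dots> = of_real (\<Omega> * \<omega>) / (4 * p\<^sup>2) * (exp_erfc p ?x + exp_erfc (- p) ?x) +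
        of_real (\<Omega> * \<omega>) / (4 * q\<^sup>2) * (exp_erfc q ?x + exp_erfc (- q) ?x)"
      unfolding D(1) sum_over_four[OF D(2)] by (simp only: power2_minus distrib_left)
    also have "\<dots> = of_real \<Omega> * ((exp (\<i> * of_real (\<omega> * t)) - exp (- (\<i> * of_real (\<omega> * t)))) / (2 * \<i>))"
      unfolding exp_erfc_add_exp_erfc_minus pq x2 using \<omega>
      by (simp add: field_simps)
    also have "\<dots> = of_real (\<Omega> * sin (\<omega> * t))"
      by (simp add: sin_exp_eq flip: sin_of_real)
    finally show "exp_erfc_sum Z (\<lambda>z. ?\<alpha> z * poly ?P z) t = of_real (\<Omega> * sin (\<omega> * t))" .
  qed
  then show ?thesis by simp
qed

text \<open>The four terms at the fourth roots of \<open>-\<omega>\<^sup>2\<close> are grouped into the pairs \<open>\<plusminus>p\<close> and \<open>\<plusminus>q\<close>. In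
  each pair the part of the coefficient that is even in \<open>z\<close> meets \<open>E\<^sub>z + E\<^bsub>-z\<^esub>\<close> and gives sine and
  cosine, and the odd part meets \<open>E\<^sub>z - E\<^bsub>-z\<^esub>\<close> and gives the Fresnel terms.\<close>

lemma bt_yf_eq_exp_erfc_sum:
  assumes four: "card {z. poly (bt_poly a b c) z = 0} = 4"
    and nonres: "\<And>z. poly (bt_poly a b c) z = 0 \<Longrightarrow> (of_real \<omega>)\<^sup>2 + z ^ 4 \<noteq> 0"
    and \<omega>: "\<omega> \<noteq> 0" and t: "t \<ge> 0"
  shows "bt_yf a b \<Omega> \<omega> (bt_root a b c) t =
    exp_erfc_sum ({z. poly (bt_poly a b c) z = 0} \<union> {z. (of_real \<omega>)\<^sup>2 + z ^ 4 = 0})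
      (bt_yf_coeff a b c \<Omega> \<omega>) t"
proof -
  let ?w = "complex_of_real \<omega>" and ?P = "bt_poly a b c" and ?\<alpha> = "bt_yf_coeff a b c \<Omega> \<omega>"
  let ?A = "{z. poly ?P z = 0}" and ?D = "{z. ?w\<^sup>2 + z ^ 4 = 0}"
  let ?x = "complex_of_real (sqrt t)" and ?r = "bt_root a b c"
  define B where "B = bt_B a b \<omega> ?r"
  note ac = bt_poly_coeffs_nonzero[OF four]
  have w0: "?w \<noteq> 0" using \<omega> by simp
  have x2: "?x\<^sup>2 = of_real t" using t by (simp flip: of_real_power)
  define p q where "p = csqrt (\<i> * ?w)" and "q = csqrt (- \<i> * ?w)"
  have pq: "p\<^sup>2 = \<i> * ?w" "q\<^sup>2 = - \<i> * ?w" by (simp_all add: p_def q_def)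
  have pq0: "p \<noteq> 0" "q \<noteq> 0" using pq w0 by auto
  note D = fourth_roots_of_minus_square[OF w0 pq]
  have finA: "finite ?A" using four by (simp add: card_ge_0_finite)
  define SA where "SA = (\<Sum>k=1..4. exp ((?r k)\<^sup>2 * of_real t) * erfc (- ?r k * ?x)
      / (?r k * (4 * of_real a * ?r k + 3 * of_real b) * (?w\<^sup>2 + ?r k ^ 4)))"
  have A: "(\<Sum>z\<in>?A. ?\<alpha> z * exp_erfc z ?x) = of_real (\<Omega> * \<omega>) * SA"
  proof -
    have "SA = (\<Sum>z\<in>?A. exp_erfc z ?x / (z * (4 * of_real a * z + 3 * of_real b) * (?w\<^sup>2 + z ^ 4)))"
      unfolding SA_def exp_erfc_sqrt[OF t] by (rule sum_bt_root[OF four])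
    moreover have "?\<alpha> z * exp_erfc z ?x = of_real (\<Omega> * \<omega>) *
        (exp_erfc z ?x / (z * (4 * of_real a * z + 3 * of_real b) * (?w\<^sup>2 + z ^ 4)))" if "z \<in> ?A" for z
    proof -
      have "z \<noteq> 0" using that ac by (auto simp: poly_bt_poly)
      have "u * z / (z\<^sup>2 * m * n) * e = u * (e / (z * m * n))" for u m n e :: complex
        using \<open>z \<noteq> 0\<close> by (simp add: power2_eq_square)
      then show ?thesis
        using that by (simp only: bt_yf_coeff_at_root poly_pderiv_bt_poly mem_Collect_eq)
    qed
    ultimately show ?thesis by (simp add: sum_distrib_left)
  qed
  \<comment> \<open>\<open>F\<close> and \<open>G\<close> are \<open>\<integral>\<^sub>0\<^sup>t cos (\<omega>\<tau>)/\<surd>(\<pi>\<tau>) d\<tau>\<close> and the same integral with \<open>sin\<close>.\<close>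
  define X where "X = csqrt (of_real (2 * \<omega> / pi * t))"
  define F G where "F = csqrt 2 / csqrt ?w * fresnel_C X" and "G = csqrt 2 / csqrt ?w * fresnel_S X"
  define C S where "C = complex_of_real (cos (\<omega> * t))" and "S = complex_of_real (sin (\<omega> * t))"
  have X: "X = csqrt ?w * of_real (sqrt (2 / pi)) * ?x"
  proof (cases "t = 0")
    case True
    then show ?thesis by (simp add: X_def)
  next
    case False
    have "2 * \<omega> / pi * t \<ge> 0 \<longleftrightarrow> \<omega> \<ge> 0"
    proof -
      define k where "k = 2 / pi * t"
      have "k > 0" using False t by (simp add: k_def)
      moreover have "2 * \<omega> / pi * t = \<omega> * k" by (simp add: k_def)
      ultimately show ?thesis by (simp only: zero_le_mult_iff) linarith
    qed
    moreover have "\<bar>2 * \<omega> / pi * t\<bar> = \<bar>\<omega>\<bar> * (2 / pi) * t" using t by (simp add: abs_mult)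
    ultimately show ?thesis
      unfolding X_def csqrt_of_real' by (simp only: real_sqrt_mult of_real_mult) simp
  qed
  have erf: "1 - erfc (y * ?x) = y * (F - \<sigma> * \<i> * G)" if "\<sigma> = 1 \<or> \<sigma> = - 1" "y\<^sup>2 = \<sigma> * \<i> * ?w" for y \<sigma>
    using erf_eq_fresnel[OF power2_csqrt _ that, of ?x] w0 csqrt_of_real[of 2]
    by (simp add: F_def G_def X algebra_simps diff_divide_distrib)
  have D_term: "?\<alpha> z * exp_erfc z ?x = - of_real (\<Omega> * \<omega>) / 4 *
      ((B (-1) + B 1 / z\<^sup>2) * exp_erfc z ?x + (B 0 + B 2 / z\<^sup>2) / z * exp_erfc z ?x)" if "z \<in> ?D" for z
  proof -
    have z: "z \<noteq> 0" using that \<omega> by auto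
    have "?\<alpha> z = of_real (\<Omega> * \<omega>) / (4 * z\<^sup>2) * - (B 2 / z + z\<^sup>2 * B (-1) + z * B 0 + B 1)"
      using bt_yf_coeff_at_pole[of \<omega> z a b c \<Omega>] inverse_bt_poly_at_pole[OF four nonres _ z] that z
      by (simp add: B_def)
    also have "\<dots> = - of_real (\<Omega> * \<omega>) / 4 * ((B (-1) + B 1 / z\<^sup>2) + (B 0 + B 2 / z\<^sup>2) / z)"
      using z by (simp add: field_simps power2_eq_square)
    finally have \<alpha>: "?\<alpha> z = - of_real (\<Omega> * \<omega>) / 4 * ((B (-1) + B 1 / z\<^sup>2) + (B 0 + B 2 / z\<^sup>2) / z)" .
    show ?thesis by (simp only: \<alpha> distrib_right mult.assoc)
  qed
  have pair: "f (y\<^sup>2) * exp_erfc y ?x + g (y\<^sup>2) / y * exp_erfc y ?x +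
      (f ((- y)\<^sup>2) * exp_erfc (- y) ?x + g ((- y)\<^sup>2) / (- y) * exp_erfc (- y) ?x) =
      2 * exp (y\<^sup>2 * of_real t) * (f (y\<^sup>2) + g (y\<^sup>2) * (F - \<sigma> * \<i> * G))"
    if "\<sigma> = 1 \<or> \<sigma> = - 1" "y\<^sup>2 = \<sigma> * \<i> * ?w" "y \<noteq> 0" for f g :: "complex \<Rightarrow> complex" and y \<sigma>
  proof -
    have "f (y\<^sup>2) * exp_erfc y ?x + g (y\<^sup>2) / y * exp_erfc y ?x +
      (f ((- y)\<^sup>2) * exp_erfc (- y) ?x + g ((- y)\<^sup>2) / (- y) * exp_erfc (- y) ?x) =
      f (y\<^sup>2) * (exp_erfc y ?x + exp_erfc (- y) ?x) + g (y\<^sup>2) / y * (exp_erfc y ?x - exp_erfc (- y) ?x)"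
      by (simp add: algebra_simps)
    also have "\<dots> = 2 * exp (y\<^sup>2 * of_real t) * (f (y\<^sup>2) + g (y\<^sup>2) / y * (y * (F - \<sigma> * \<i> * G)))"
      unfolding exp_erfc_add_exp_erfc_minus exp_erfc_diff_exp_erfc_minus x2 erf[OF that(1,2)]
      by (simp only: distrib_left mult_ac)
    finally show ?thesis using that(3) by simp
  qed
  have "(\<Sum>z\<in>?D. ?\<alpha> z * exp_erfc z ?x) = - of_real (\<Omega> * \<omega>) / 4 *
      (\<Sum>z\<in>?D. (B (-1) + B 1 / z\<^sup>2) * exp_erfc z ?x + (B 0 + B 2 / z\<^sup>2) / z * exp_erfc z ?x)"
    unfolding sum_distrib_left by (rule sum.cong[OF refl D_term])
  also have "(\<Sum>z\<in>?D. (B (-1) + B 1 / z\<^sup>2) * exp_erfc z ?x + (B 0 + B 2 / z\<^sup>2) / z * exp_erfc z ?x) =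
      2 * exp (p\<^sup>2 * of_real t) * ((B (-1) + B 1 / p\<^sup>2) + (B 0 + B 2 / p\<^sup>2) * (F - 1 * \<i> * G)) +
      2 * exp (q\<^sup>2 * of_real t) * ((B (-1) + B 1 / q\<^sup>2) + (B 0 + B 2 / q\<^sup>2) * (F - (-1) * \<i> * G))"
    unfolding D(1) sum_over_four[OF D(2)]
    using pair[of 1 p "\<lambda>u. B (-1) + B 1 / u" "\<lambda>u. B 0 + B 2 / u"]
      pair[of "-1" q "\<lambda>u. B (-1) + B 1 / u" "\<lambda>u. B 0 + B 2 / u"] pq pq0
    by simp
  also have "exp (p\<^sup>2 * of_real t) = C + \<i> * S"
  proof -
    have "p\<^sup>2 * of_real t = \<i> * of_real (\<omega> * t)" by (simp add: pq)
    then show ?thesis by (simp only: exp_Euler C_def S_def cos_of_real sin_of_real)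
  qed
  also have "exp (q\<^sup>2 * of_real t) = C - \<i> * S"
  proof -
    have "q\<^sup>2 * of_real t = - (\<i> * of_real (\<omega> * t))" by (simp add: pq)
    then show ?thesis by (simp only: exp_minus_Euler C_def S_def cos_of_real sin_of_real)
  qed
  also have "2 * (C + \<i> * S) * ((B (-1) + B 1 / p\<^sup>2) + (B 0 + B 2 / p\<^sup>2) * (F - 1 * \<i> * G)) +
      2 * (C - \<i> * S) * ((B (-1) + B 1 / q\<^sup>2) + (B 0 + B 2 / q\<^sup>2) * (F - (-1) * \<i> * G)) =
      4 * (B (-1) * C + B 1 * S / ?w + B 0 * (C * F + S * G) + B 2 * (S * F - C * G) / ?w)"
  proof -
    have "1 / p\<^sup>2 = - \<i> / ?w" "1 / q\<^sup>2 = \<i> / ?w" using w0 by (simp_all add: pq field_simps)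
    then have e: "B k / p\<^sup>2 = - \<i> * (B k / ?w)" "B k / q\<^sup>2 = \<i> * (B k / ?w)" for k
      by (simp_all add: divide_inverse)
    have expand: "2 * (C + \<i> * S) * ((u + - \<i> * v) + (m + - \<i> * n) * (F - 1 * \<i> * G)) +
      2 * (C - \<i> * S) * ((u + \<i> * v) + (m + \<i> * n) * (F - (-1) * \<i> * G)) =
      4 * (u * C + v * S + m * (C * F + S * G) + n * (S * F - C * G))" for u v m n :: complex
      by (simp add: algebra_simps)
    show ?thesis unfolding e expand by (simp only: times_divide_eq_left)
  qed
  also have "- k / 4 * (4 * X) = - k * X" for k X :: complex by simp
  finally have Dsum: "(\<Sum>z\<in>?D. ?\<alpha> z * exp_erfc z ?x) = - of_real (\<Omega> * \<omega>) *
      (B (-1) * C + B 1 * S / ?w + B 0 * (C * F + S * G) + B 2 * (S * F - C * G) / ?w)" .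
  have "exp_erfc_sum (?A \<union> ?D) ?\<alpha> t = of_real (\<Omega> * \<omega>) * SA - of_real (\<Omega> * \<omega>) *
      (B (-1) * C + B 1 * S / ?w + B 0 * (C * F + S * G) + B 2 * (S * F - C * G) / ?w)"
  proof -
    have "finite ?D" by (simp add: D(1))
    moreover have "?A \<inter> ?D = {}" using nonres by auto
    ultimately show ?thesis
      unfolding exp_erfc_sum_def by (subst sum.union_disjoint[OF finA]) (simp_all only: A Dsum, simp)
  qed
  also have "\<dots> = of_real \<Omega> * (?w * (SA - B (-1) * C) - B 1 * S) +
      of_real \<Omega> * (G * (B 2 * C - B 0 * ?w * S) - F * (B 2 * S + B 0 * ?w * C))"
  proof -
    have cancel: "of_real (\<Omega> * \<omega>) * (x + u / ?w + y + v / ?w) = of_real \<Omega> * (?w * x + u + ?w * y + v)" for x u y v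
      using w0 by (simp add: field_simps)
    show ?thesis unfolding cancel by (simp add: algebra_simps)
  qed
  also have "\<dots> = bt_yf a b \<Omega> \<omega> ?r t"
    unfolding bt_yf_def Let_def B_def[symmetric] SA_def[symmetric] X_def[symmetric]
      C_def[symmetric] S_def[symmetric] F_def G_def
    by (simp add: algebra_simps)
  finally show ?thesis ..
qed

theorem theorem9:
  fixes a b c \<Omega> \<omega> y0 v0 :: real
  assumes four_roots: "card {z. poly (bt_poly a b c) z = 0} = 4"
    and nonresonant: "\<And>z. poly (bt_poly a b c) z = 0 \<Longrightarrow> (of_real \<omega>)^2 + z ^ 4 \<noteq> 0"
  shows "bij_betw (bt_root a b c) {1..4} {z. poly (bt_poly a b c) z = 0} \<and>
    (\<exists>y. bagley_torvik_solution a b c \<Omega> \<omega> y0 v0 y) \<and>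
    (\<forall>y. bagley_torvik_solution a b c \<Omega> \<omega> y0 v0 y \<longrightarrow>
       (\<forall>t\<ge>0. complex_of_real (y t) =
          bt_yf a b \<Omega> \<omega> (bt_root a b c) t + bt_yc a b y0 v0 (bt_root a b c) t))"
proof -
  note a = bt_poly_coeffs_nonzero(1)[OF four_roots]
  obtain Yf where Yf: "\<And>t. t \<ge> 0 \<Longrightarrow> bt_yf a b \<Omega> \<omega> (bt_root a b c) t = Yf t"
    and Yf_sol: "\<And>L. bounded_linear L \<Longrightarrow> bagley_torvik_solution a b c (\<Omega> * L 1) \<omega> 0 0 (\<lambda>t. L (Yf t))"
  proof (cases "\<omega> = 0")
    \<comment> \<open>Without forcing \<open>y\<^sub>f = 0\<close>; the fourth roots of \<open>-\<omega>\<^sup>2\<close> would coincide here.\<close>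
    case True
    show ?thesis
    proof (rule that[of "exp_erfc_sum {} (\<lambda>_. 0)"])
      show "bt_yf a b \<Omega> \<omega> (bt_root a b c) t = exp_erfc_sum {} (\<lambda>_. 0) t" for t
        using True by (simp add: bt_yf_def exp_erfc_sum_def)
      show "bagley_torvik_solution a b c (\<Omega> * L 1) \<omega> 0 0 (\<lambda>t. L (exp_erfc_sum {} (\<lambda>_. 0) t))"
        if "bounded_linear L" for L
        using exp_erfc_sum_solution[OF that, of "{}" "\<lambda>_. 0" 0 0 a b c \<Omega> \<omega>] True
        by (simp add: exp_erfc_sum_def)
    qed
  next
    case False
    then show ?thesis
      using that[OF bt_yf_eq_exp_erfc_sum[OF four_roots nonresonant False]]
        bt_yf_solution[OF four_roots nonresonant False] by blast
  qed
  define Y where "Y t = Yf t + exp_erfc_sum {z. poly (bt_poly a b c) z = 0} (bt_yc_coeff a b c y0 v0) t" for t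
  have Y: "bt_yf a b \<Omega> \<omega> (bt_root a b c) t + bt_yc a b y0 v0 (bt_root a b c) t = Y t" if "t \<ge> 0" for t
    by (simp add: Y_def Yf[OF that] bt_yc_eq_exp_erfc_sum[OF four_roots that])
  have Y_sol: "bagley_torvik_solution a b c (\<Omega> * L 1) \<omega> (y0 * L 1) (v0 * L 1) (\<lambda>t. L (Y t))"
    if L: "bounded_linear L" for L
    using bagley_torvik_solution_lincomb[OF Yf_sol[OF L] bt_yc_solution[OF four_roots L], of 1]
    by (simp add: Y_def linear_add[OF bounded_linear.linear[OF L]])
  have Re: "bagley_torvik_solution a b c \<Omega> \<omega> y0 v0 (\<lambda>t. Re (Y t))"
    using Y_sol[OF bounded_linear_Re] by simp
  have Im: "Im (Y t) = 0" if "t \<ge> 0" for t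
    using homogeneous_solution_eq_zero[OF a _ that] Y_sol[OF bounded_linear_Im] by simp
  have "complex_of_real (y t) = Y t" if "bagley_torvik_solution a b c \<Omega> \<omega> y0 v0 y" "t \<ge> 0" for y t
    using bagley_torvik_solution_unique[OF a that(1) Re that(2)] Im[OF that(2)]
    by (simp add: complex_eq_iff)
  then show ?thesis
    using bij_betw_bt_root[OF four_roots] Re Y by metis
qed

end
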